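(* Let $\alpha>0$ be irrational, and consider dissipative flow of slope $\alpha$ on a system $\mathcal{P}$ obtained from a finite polysquare translation surface by the inclusion of a one-sided barrier $B$ on the common vertical edge of two neighbouring atomic squares, in the form of a union of finitely many vertical intervals, where a set $A$ corresponding to $B$ has been chosen on a different vertical edge on the same horizontal street that contains $B$. Suppose further that a component $\mathcal{C}$ of the recurrent set $\mathcal{R}(\mathcal{P};\alpha)$ contains a non-empty open subset $G$. Then this component $\mathcal{C}$ can be constructed (from $G$, by the dissipative flow of slope $\alpha$) by a finite number of zig-zaggings, and is a finite union of polygons with boundary edges that are vertical or of slope $\alpha$.
   Context: A finite polysquare translation surface is a connected surface obtained from finitely many axis-parallel unit squares (atomic squares) by identifying right edges with left edges, and top edges with bottom edges, in pairs by translation. A horizontal street is a maximal (cyclic) chain of atomic squares successively adjacent through vertical edges. Each vertical edge is identified with $[0,1)$ by relative height. The barrier is $B=J$ on one vertical edge (common to two neighbouring atomic squares) and $A$ is the corresponding copy of $J$, at the same heights, on a different vertical edge of the same horizontal street, where $J\subset[0,1)$ is a union of finitely many intervals of positive length. Dissipative flow of slope $\alpha$ on $\mathcal{P}$: a flow line moves from left to right at unit speed in direction $(1,\alpha)$ as the ordinary geodesic flow on the surface, except that whenever it hits a point of $B$ from the left it continues, in the same direction, from the corresponding point (same height) of $A$. (A flow line that starts on $B$ emanates from the right side of $B$.) Flow lines that hit a singularity where the continuation is undefined come from a set of measure $0$ and are ignored. For $t\ge0$, $\mathbf{T}_\alpha^{(t)}$ advances a point along its dissipative flow line by time $t$. A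 point $P\in\mathcal{P}$ is wandering if there exist an open neighbourhood $D$ of $P$ and $t_0\ge0$ with $D\cap\mathbf{T}_\alpha^{(t)}(D)=\emptyset$ for every $t>t_0$; otherwise it is non-wandering. The recurrent set $\mathcal{R}(\mathcal{P};\alpha)$ is the set of non-wandering points. A component of $\mathcal{R}(\mathcal{P};\alpha)$ is a minimal flow-invariant part of it: a measurable subset $\mathcal{C}\subset\mathcal{R}(\mathcal{P};\alpha)$ of positive area, invariant under dissipative flow of slope $\alpha$, which has no invariant measurable subset of area strictly between $0$ and $\lambda_2(\mathcal{C})$, where $\lambda_2$ is $2$-dimensional Lebesgue measure. A zig-zagging is a traverse by the flow between the opposite vertical edges of an atomic square (taking time $(1+\alpha^2)^{1/2}$); that $\mathcal{C}$ can be constructed from $G$ by a finite number of zig-zaggings means that there is a finite $T_0$ such that $\mathcal{C}=\bigcup_{0\le t\le T_0}\mathbf{T}_\alpha^{(t)}(G)$. Sets of $2$-dimensional Lebesgue measure $0$ are disregarded in this equality and in the description of $\mathcal{C}$ as a finite union of polygons. *)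

theory Defs
  imports "HOL-Analysis.Analysis"
begin

section \<open>Polysquare translation surfaces\<close>

text \<open>
  The right edge of the atomic square \<open>s\<close> is glued to the left edge of \<open>rgt X s\<close>, and its top
  edge to the bottom edge of \<open>upw X s\<close>.
\<close>

record 's polysquare =
  squares :: "'s set"
  rgt :: "'s \<Rightarrow> 's"
  upw :: "'s \<Rightarrow> 's"

definition unit_square :: "(real \<times> real) set" where
  "unit_square = {0..1} \<times> {0..1}"

definition gluing :: "('s, 'm) polysquare_scheme \<Rightarrow> (('s \<times> real \<times> real) \<times> ('s \<times> real \<times> real)) set"
  where
  "gluing X =
     {((s, 1, y), (rgt X s, 0, y)) | s y. s \<in> squares X \<and> y \<in> {0..1}} \<union>
     {((s, x, 1), (upw X s, x, 0)) | s x. s \<in> squares X \<and> x \<in> {0..1}}"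

text \<open>Points of the surface are the classes of the equivalence relation generated by the gluing.\<close>

type_synonym 's pt = "('s \<times> real \<times> real) set"

definition pt :: "('s, 'm) polysquare_scheme \<Rightarrow> 's \<Rightarrow> real \<times> real \<Rightarrow> 's pt" where
  "pt X s z = ((gluing X \<union> (gluing X)\<inverse>)\<^sup>*) `` {(s, z)}"

definition surface :: "('s, 'm) polysquare_scheme \<Rightarrow> 's pt set" where
  "surface X = (\<Union>s\<in>squares X. pt X s ` unit_square)"

definition in_square :: "('s, 'm) polysquare_scheme \<Rightarrow> 's pt set \<Rightarrow> 's \<Rightarrow> (real \<times> real) set" where
  "in_square X D s = {z \<in> unit_square. pt X s z \<in> D}"

text \<open>The quotient topology of the disjoint union of the closed atomic squares.\<close>

definition surface_open :: "('s, 'm) polysquare_scheme \<Rightarrow> 's pt set \<Rightarrow> bool" where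
  "surface_open X D \<longleftrightarrow> D \<subseteq> surface X \<and>
     (\<forall>s\<in>squares X. openin (top_of_set unit_square) (in_square X D s))"

definition surface_topology :: "('s, 'm) polysquare_scheme \<Rightarrow> 's pt topology" where
  "surface_topology X = topology (surface_open X)"

lemma istopology_surface_open: "istopology (surface_open X)"
  unfolding istopology_def
proof (intro conjI allI impI)
  fix D E assume D: "surface_open X D" and E: "surface_open X E"
  have "in_square X (D \<inter> E) s = in_square X D s \<inter> in_square X E s" for s
    by (auto simp: in_square_def)
  with D E show "surface_open X (D \<inter> E)"
    by (auto simp: surface_open_def)
next
  fix K assume K: "\<forall>D\<in>K. surface_open X D"
  have "in_square X (\<Union>K) s = (\<Union>D\<in>K. in_square X D s)" for s
    by (auto simp: in_square_def)
  with K show "surface_open X (\<Union>K)"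
    by (auto simp: surface_open_def)
qed

lemma openin_surface_topology: "openin (surface_topology X) D \<longleftrightarrow> surface_open X D"
  by (simp add: surface_topology_def istopology_surface_open topology_inverse')

lemma topspace_surface_topology: "topspace (surface_topology X) = surface X"
proof -
  have "in_square X (surface X) s = unit_square" if "s \<in> squares X" for s
    using that by (auto simp: in_square_def surface_def)
  then have "surface_open X (surface X)"
    by (simp add: surface_open_def)
  then show ?thesis
    by (auto simp: topspace_def openin_surface_topology surface_open_def)
qed

definition finite_polysquare_surface :: "('s, 'm) polysquare_scheme \<Rightarrow> bool" where
  "finite_polysquare_surface X \<longleftrightarrow>
     finite (squares X) \<and>
     bij_betw (rgt X) (squares X) (squares X) \<and>
     bij_betw (upw X) (squares X) (squares X) \<and>
     connected_space (surface_topology X)"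

text \<open>
  Going once around the upper right corner of \<open>s\<close> returns to \<open>s\<close> iff \<open>rgt\<close> and \<open>upw\<close> commute at
  \<open>s\<close>, i.e. iff the total angle at this vertex is \<open>2\<pi>\<close>.
\<close>

definition regular_corner :: "('s, 'm) polysquare_scheme \<Rightarrow> 's \<Rightarrow> bool" where
  "regular_corner X s \<longleftrightarrow> upw X (rgt X s) = rgt X (upw X s)"

definition singularities :: "('s, 'm) polysquare_scheme \<Rightarrow> 's pt set" where
  "singularities X = {pt X s (1, 1) | s. s \<in> squares X \<and> \<not> regular_corner X s}"

text \<open>Two-dimensional Lebesgue measure; edges have measure zero, so charts may overlap there.\<close>

definition surface_measurable :: "('s, 'm) polysquare_scheme \<Rightarrow> 's pt set \<Rightarrow> bool" where
  "surface_measurable X E \<longleftrightarrow> E \<subseteq> surface X \<and> (\<forall>s\<in>squares X. in_square X E s \<in> sets lebesgue)"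

definition area :: "('s, 'm) polysquare_scheme \<Rightarrow> 's pt set \<Rightarrow> ennreal" where
  "area X E = (\<Sum>s\<in>squares X. emeasure lebesgue (in_square X E s))"

definition surface_null :: "('s, 'm) polysquare_scheme \<Rightarrow> 's pt set \<Rightarrow> bool" where
  "surface_null X E \<longleftrightarrow> (\<forall>s\<in>squares X. in_square X E s \<in> null_sets lebesgue)"

definition equal_ae :: "('s, 'm) polysquare_scheme \<Rightarrow> 's pt set \<Rightarrow> 's pt set \<Rightarrow> bool" where
  "equal_ae X E F \<longleftrightarrow> surface_null X ((E - F) \<union> (F - E))"


section \<open>Dissipative flow\<close>

definition street :: "('s, 'm) polysquare_scheme \<Rightarrow> 's \<Rightarrow> 's set" where
  "street X s = {(rgt X ^^ n) s | n. True}"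

definition finite_interval_union :: "real set \<Rightarrow> bool" where
  "finite_interval_union J \<longleftrightarrow>
     (\<exists>F. finite F \<and> F \<noteq> {} \<and> J = \<Union>F \<and>
          (\<forall>I\<in>F. is_interval I \<and> (\<exists>x\<in>I. \<exists>y\<in>I. x < y)))"

text \<open>
  A vertical edge is named by the atomic square to its left.  The barrier \<open>B\<close> is the part of the
  right edge of \<open>bar X\<close> at heights \<open>heights X\<close>, and \<open>A\<close> is its copy on the right edge of \<open>img X\<close>.
\<close>

record 's barrier_system = "'s polysquare" +
  bar :: 's
  img :: 's
  heights :: "real set"

definition one_sided_barrier_system :: "'s barrier_system \<Rightarrow> bool" where
  "one_sided_barrier_system X \<longleftrightarrow>
     finite_polysquare_surface X \<and>
     bar X \<in> squares X \<and> img X \<in> street X (bar X) \<and> img X \<noteq> bar X \<and>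
     heights X \<subseteq> {0..<1} \<and> finite_interval_union (heights X)"

definition barrier :: "'s barrier_system \<Rightarrow> 's pt set" where
  "barrier X = {pt X (bar X) (1, h) | h. h \<in> heights X}"

text \<open>
  \<open>flow X \<alpha> t P Q\<close>: the flow line of slope \<open>\<alpha>\<close> starting at \<open>P\<close> is at \<open>Q\<close> after time \<open>t\<close>.
  A segment inside one closed atomic square with positive horizontal displacement \<open>d\<close> takes time
  \<open>d * sqrt (1 + \<alpha>\<^sup>2)\<close>.  If it ends on the barrier, it has hit the barrier from the left and
  is moved to \<open>A\<close>.  A line starting on the barrier is governed by the square to its right
  (\<open>x = 0\<close>).  The flow is undefined from the moment a singularity is hit; the other vertices are
  passed as ordinary points of the surface.
\<close>

inductive flow :: "'s barrier_system \<Rightarrow> real \<Rightarrow> real \<Rightarrow> 's pt \<Rightarrow> 's pt \<Rightarrow> bool"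
  for X :: "'s barrier_system" and \<alpha> :: real where
  flow_refl:
    "P \<in> surface X \<Longrightarrow> P \<notin> singularities X \<Longrightarrow> flow X \<alpha> 0 P P"
| flow_segment:
    "s \<in> squares X \<Longrightarrow> 0 \<le> x \<Longrightarrow> 0 \<le> y \<Longrightarrow> 0 < d \<Longrightarrow> x + d \<le> 1 \<Longrightarrow> y + \<alpha> * d \<le> 1 \<Longrightarrow>
     pt X s (x, y) \<notin> singularities X \<Longrightarrow>
     pt X s (x + d, y + \<alpha> * d) \<notin> singularities X \<Longrightarrow>
     pt X s (x + d, y + \<alpha> * d) \<notin> barrier X \<Longrightarrow>
     flow X \<alpha> (d * sqrt (1 + \<alpha>\<^sup>2)) (pt X s (x, y)) (pt X s (x + d, y + \<alpha> * d))"
| flow_barrier: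
    "s \<in> squares X \<Longrightarrow> 0 \<le> x \<Longrightarrow> 0 \<le> y \<Longrightarrow> 0 < d \<Longrightarrow> x + d \<le> 1 \<Longrightarrow> y + \<alpha> * d \<le> 1 \<Longrightarrow>
     pt X s (x, y) \<notin> singularities X \<Longrightarrow>
     pt X s (x + d, y + \<alpha> * d) \<notin> singularities X \<Longrightarrow>
     h \<in> heights X \<Longrightarrow> pt X s (x + d, y + \<alpha> * d) = pt X (bar X) (1, h) \<Longrightarrow>
     pt X (img X) (1, h) \<notin> singularities X \<Longrightarrow>
     flow X \<alpha> (d * sqrt (1 + \<alpha>\<^sup>2)) (pt X s (x, y)) (pt X (img X) (1, h))"
| flow_trans:
    "flow X \<alpha> t P Q \<Longrightarrow> flow X \<alpha> t' Q R \<Longrightarrow> flow X \<alpha> (t + t') P R"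

definition advance :: "'s barrier_system \<Rightarrow> real \<Rightarrow> real \<Rightarrow> 's pt set \<Rightarrow> 's pt set" where
  "advance X \<alpha> t D = {Q. \<exists>P\<in>D. flow X \<alpha> t P Q}"

definition wandering :: "'s barrier_system \<Rightarrow> real \<Rightarrow> 's pt \<Rightarrow> bool" where
  "wandering X \<alpha> P \<longleftrightarrow>
     (\<exists>D t0. openin (surface_topology X) D \<and> P \<in> D \<and> 0 \<le> t0 \<and>
             (\<forall>t>t0. D \<inter> advance X \<alpha> t D = {}))"

definition recurrent_set :: "'s barrier_system \<Rightarrow> real \<Rightarrow> 's pt set" where
  "recurrent_set X \<alpha> = {P \<in> surface X. \<not> wandering X \<alpha> P}"

definition flow_invariant :: "'s barrier_system \<Rightarrow> real \<Rightarrow> 's pt set \<Rightarrow> bool" where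
  "flow_invariant X \<alpha> E \<longleftrightarrow> (\<forall>t\<ge>0. advance X \<alpha> t E \<subseteq> E)"

definition recurrent_component :: "'s barrier_system \<Rightarrow> real \<Rightarrow> 's pt set \<Rightarrow> bool" where
  "recurrent_component X \<alpha> C \<longleftrightarrow>
     C \<subseteq> recurrent_set X \<alpha> \<and> surface_measurable X C \<and> 0 < area X C \<and> flow_invariant X \<alpha> C \<and>
     \<not> (\<exists>E\<subseteq>C. surface_measurable X E \<and> flow_invariant X \<alpha> E \<and>
               0 < area X E \<and> area X E < area X C)"


section \<open>Polygons\<close>

text \<open>
  A planar polygon is a simple closed curve made of finitely many segments, together with its
  inside.
\<close>

definition vertical_or_slope :: "real \<Rightarrow> real \<times> real \<Rightarrow> real \<times> real \<Rightarrow> bool" where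
  "vertical_or_slope \<alpha> p q \<longleftrightarrow> fst q = fst p \<or> snd q - snd p = \<alpha> * (fst q - fst p)"

definition planar_polygon :: "real \<Rightarrow> (real \<times> real) set \<Rightarrow> bool" where
  "planar_polygon \<alpha> K \<longleftrightarrow>
     (\<exists>g E. simple_path g \<and> pathfinish g = pathstart g \<and>
            finite E \<and> (\<forall>(p, q)\<in>E. vertical_or_slope \<alpha> p q) \<and>
            path_image g = (\<Union>(p, q)\<in>E. closed_segment p q) \<and>
            K = path_image g \<union> inside (path_image g))"

text \<open>
  \<open>patch X s\<close> lays out \<open>s\<close> and its right, upper and upper right neighbours as \<open>[0,2) \<times> [0,2)\<close>.
  On \<open>patch_domain X s\<close> this is a translation chart of the surface: the four squares fit together
  around the corner \<open>(1,1)\<close> only if that corner is regular; otherwise only the two pairs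
  of adjacent squares are used.
\<close>

definition patch :: "('s, 'm) polysquare_scheme \<Rightarrow> 's \<Rightarrow> real \<times> real \<Rightarrow> 's pt" where
  "patch X s = (\<lambda>(x, y).
     if x < 1 \<and> y < 1 then pt X s (x, y)
     else if y < 1 then pt X (rgt X s) (x - 1, y)
     else if x < 1 then pt X (upw X s) (x, y - 1)
     else pt X (upw X (rgt X s)) (x - 1, y - 1))"

definition patch_domain :: "('s, 'm) polysquare_scheme \<Rightarrow> 's \<Rightarrow> (real \<times> real) set" where
  "patch_domain X s =
     {0<..<2} \<times> {0<..<1} \<union> {0<..<1} \<times> {0<..<2} \<union>
     (if regular_corner X s then {0<..<2} \<times> {0<..<2} else {})"

definition local_translation ::
    "('s, 'm) polysquare_scheme \<Rightarrow> (real \<times> real) set \<Rightarrow> (real \<times> real \<Rightarrow> 's pt) \<Rightarrow> bool" where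
  "local_translation X U f \<longleftrightarrow>
     (\<forall>p\<in>U. \<exists>s\<in>squares X. \<exists>w. \<exists>e>0. \<forall>q\<in>ball p e.
        q - w \<in> patch_domain X s \<and> f q = patch X s (q - w))"

text \<open>
  A polygon on the surface may cross edges of atomic squares; it is a planar polygon laid on the
  surface without overlap of its interior.  Its boundary may contain singularities.
\<close>

definition surface_polygon :: "('s, 'm) polysquare_scheme \<Rightarrow> real \<Rightarrow> 's pt set \<Rightarrow> bool" where
  "surface_polygon X \<alpha> Q \<longleftrightarrow>
     (\<exists>K f. planar_polygon \<alpha> K \<and>
            continuous_map (top_of_set K) (surface_topology X) f \<and>
            local_translation X (interior K) f \<and> inj_on f (interior K) \<and> Q = f ` K)"

end

theory Submission
  imports Defs
begin

text \<open>
  Cut the flow along the vertical edges.  The return map to these edges is a piecewise translation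
  with finitely many discontinuities, and a subset of the edges that it maps into itself sweeps out a
  flow-invariant subset of the surface.  A small interval of an edge that is reached from \<open>G\<close> has a
  forward orbit \<open>E\<close> that is open and sweeps out \<open>\<C>\<close>, because \<open>\<C>\<close> is minimal.

  For small \<open>\<epsilon>\<close> the union of the intervals of length at least \<open>\<epsilon>\<close> in \<open>E\<close> is again mapped into itself,
  so it is \<open>E\<close> by minimality, and \<open>E\<close> is a finite union of intervals.  The parallelograms over
  these intervals are the polygons.

  For the finite time, the first \<open>k\<close> images of the interval cover, by compactness, all of \<open>E\<close> up to
  small neighbourhoods of the \<open>m\<close> endpoints of \<open>E\<close>.  A backward orbit of length \<open>m\<close> must leave these
  neighbourhoods since \<open>\<alpha>\<close> is irrational; hence the \<open>m\<close>-th image of \<open>E\<close>, which by minimality still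
  sweeps out \<open>\<C>\<close>, is covered by the first \<open>k + m\<close> images of the interval.
\<close>

section \<open>The flow on generic points\<close>

text \<open>Two exceptional sets of heights are kept apart. \<open>special\<close> is countable and
  stable under translation by 1 and \<open>\<alpha>\<close>, so a line that avoids it once never
  meets a vertex or an endpoint of the barrier. On \<open>edge_points\<close> the return map can
  therefore be iterated forever, and the discarded lines form a null set. For irrational slope,
  however, \<open>special\<close> is dense, and removing it would destroy the intervals on which the
  argument rests. Openness is therefore tracked with \<open>push\<close>, which omits only the
  locally finite set \<open>jumps\<close>; a set is intersected with \<open>edge_points\<close> just
  before it is swept out.

  The return map is not injective, because lines diverted by the barrier arrive where the lines
  through \<open>A\<close> arrive as well. So no inverse map is at hand. Its place is taken by
  minimality: any nonempty open part of the orbit that \<open>push\<close> maps into itself already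
  sweeps out the component up to measure zero.\<close>

locale dissipative_flow =
  fixes X :: "'s barrier_system" and \<alpha> :: real
  assumes slope_pos: "0 < \<alpha>"
    and barrier_system: "one_sided_barrier_system X"
begin

lemma finite_squares: "finite (squares X)"
  and bij_rgt: "bij_betw (rgt X) (squares X) (squares X)"
  and bij_upw: "bij_betw (upw X) (squares X) (squares X)"
  and bar_square: "bar X \<in> squares X"
  and heights_unit: "heights X \<subseteq> {0..<1}"
  using barrier_system
  by (auto simp: one_sided_barrier_system_def finite_polysquare_surface_def)

lemma rgt_square: "s \<in> squares X \<Longrightarrow> rgt X s \<in> squares X"
  using bij_rgt by (auto simp: bij_betw_def)

lemma upw_square: "s \<in> squares X \<Longrightarrow> (upw X ^^ n) s \<in> squares X"
  using bij_upw by (induction n) (auto simp: bij_betw_def)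

lemma upw_inject:
  assumes "s \<in> squares X" "s' \<in> squares X" "(upw X ^^ n) s = (upw X ^^ n) s'"
  shows "s = s'"
  using assms
proof (induction n)
  case (Suc n)
  then have "(upw X ^^ n) s = (upw X ^^ n) s'"
    using bij_betw_imp_inj_on[OF bij_upw] upw_square[of s n] upw_square[of s' n]
    by (auto dest: inj_onD)
  with Suc show ?case
    by simp
qed auto

lemma img_square: "img X \<in> squares X"
proof -
  have "(rgt X ^^ n) (bar X) \<in> squares X" for n
    by (induction n) (auto simp: bar_square rgt_square)
  then show ?thesis
    using barrier_system by (auto simp: one_sided_barrier_system_def street_def)
qed

text \<open>A bounded interval has no frontier points besides its infimum and supremum, and the
  frontier of a finite union lies in the union of the frontiers. Later this makes the
  discontinuities of the return map locally finite.\<close>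

lemma finite_frontier_heights: "finite (frontier (heights X))"
proof -
  obtain F where F: "finite F" "heights X = \<Union>F" "\<And>I. I \<in> F \<Longrightarrow> is_interval I"
    using barrier_system unfolding one_sided_barrier_system_def finite_interval_union_def by metis
  have "finite (frontier I)" if "I \<in> F" for I
  proof (cases "I = {}")
    case False
    have I: "I \<subseteq> {0..1}"
      using that F(2) heights_unit by force
    have "interior I \<supseteq> {Inf I<..<Sup I}"
    proof (rule interior_maximal)
      show "{Inf I<..<Sup I} \<subseteq> I"
      proof
        fix y assume y: "y \<in> {Inf I<..<Sup I}"
        obtain a where "a \<in> I" "a < y"
          using y False cInf_lessD[of I y] by auto
        moreover obtain b where "b \<in> I" "y < b"
          using y False less_cSupD[of I y] by auto
        ultimately show "y \<in> I"
          using F(3)[OF that] unfolding is_interval_1 by (meson less_imp_le)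
      qed
    qed auto
    moreover have "closure I \<subseteq> {Inf I..Sup I}"
    proof (rule closure_minimal)
      have "bdd_below I" "bdd_above I"
        using I by (meson bdd_below_Icc bdd_below_mono, meson bdd_above_Icc bdd_above_mono)
      then show "I \<subseteq> {Inf I..Sup I}"
        by (auto intro: cInf_lower cSup_upper)
    qed auto
    ultimately have "frontier I \<subseteq> {Inf I..Sup I} - {Inf I<..<Sup I}"
      unfolding frontier_def by blast
    also have "\<dots> \<subseteq> {Inf I, Sup I}"
      by auto
    finally show ?thesis
      using finite_subset by blast
  qed auto
  moreover have "frontier (\<Union>F) \<subseteq> (\<Union>I\<in>F. frontier I)"
    using frontier_Union_subset[of F] F(1) by simp
  ultimately show ?thesis
    using F(1,2) by (metis (no_types, lifting) finite_UN finite_subset)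
qed

text \<open>
  The line of slope \<open>\<alpha>\<close> through \<open>(x, y)\<close> has intercept \<open>y - \<alpha> * x\<close>.  Gluing and flow change it only by
  elements of \<open>\<int> + \<int>\<alpha>\<close>; it lies in the countable set \<open>special\<close> for all lines that meet a vertex or an
  endpoint of the barrier.
\<close>

definition special :: "real set" where
  "special = (\<lambda>(h, m, n). h + of_int m + of_int n * \<alpha>) ` (insert 0 (frontier (heights X)) \<times> UNIV \<times> UNIV)"

lemma countable_special: "countable special"
  unfolding special_def using finite_frontier_heights by (intro countable_image countable_SIGMA) (auto intro: countable_finite)

lemma special_shiftI: "c \<in> special \<Longrightarrow> c + of_int m + of_int n * \<alpha> \<in> special"
  unfolding special_def
proof (clarsimp, goal_cases)
  case (1 h m' n')
  have "h + of_int m' + of_int n' * \<alpha> + of_int m + of_int n * \<alpha>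
      = (\<lambda>(h, m, n). h + of_int m + of_int n * \<alpha>) (h, m' + m, n' + n)"
    by (simp add: algebra_simps)
  with 1 show ?case
    by (intro image_eqI[where x = "(h, m' + m, n' + n)"]) auto
qed

lemma special_shift: "c + of_int m + of_int n * \<alpha> \<in> special \<longleftrightarrow> c \<in> special"
  using special_shiftI[of c m n] special_shiftI[of "c + of_int m + of_int n * \<alpha>" "-m" "-n"]
  by auto

lemma special_add_int: "c + of_int m \<in> special \<longleftrightarrow> c \<in> special"
  using special_shift[of c m 0] by simp

lemma special_diff_slope: "c - \<alpha> \<in> special \<longleftrightarrow> c \<in> special"
  using special_shift[of c 0 "-1"] by simp

lemma special_add_slope: "c + \<alpha> \<in> special \<longleftrightarrow> c \<in> special"
  using special_shift[of c 0 1] by simp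

lemma special_frac: "frac c \<in> special \<longleftrightarrow> c \<in> special"
  using special_add_int[of c "-\<lfloor>c\<rfloor>"] by (simp add: frac_def)

lemma frontier_special: "h \<in> frontier (heights X) \<Longrightarrow> h \<in> special"
  unfolding special_def by (rule image_eqI[of _ _ "(h, 0, 0)"]) auto

lemma int_special: "of_int m \<in> special"
  unfolding special_def by (rule image_eqI[of _ _ "(0, m, 0)"]) auto

lemma zero_special: "0 \<in> special" and one_special: "1 \<in> special"
  using int_special[of 0] int_special[of 1] by auto

definition generic :: "'s \<times> real \<times> real \<Rightarrow> bool" where
  "generic p \<longleftrightarrow> snd (snd p) - \<alpha> * fst (snd p) \<notin> special"

text \<open>A generic point of the closed square is never a corner, so at most one of the first two
  cases applies and the result lies in \<open>[0,1) \<times> [0,1)\<close>. This singles out one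
  representative in each generic class.\<close>

definition normal_form :: "'s \<times> real \<times> real \<Rightarrow> 's \<times> real \<times> real" where
  "normal_form = (\<lambda>(s, x, y). if x = 1 then (rgt X s, 0, y) else if y = 1 then (upw X s, x, 0) else (s, x, y))"

lemma pt_rgt: "s \<in> squares X \<Longrightarrow> 0 \<le> y \<Longrightarrow> y \<le> 1 \<Longrightarrow> pt X s (1, y) = pt X (rgt X s) (0, y)"
  and pt_upw: "s \<in> squares X \<Longrightarrow> 0 \<le> x \<Longrightarrow> x \<le> 1 \<Longrightarrow> pt X s (x, 1) = pt X (upw X s) (x, 0)"
proof -
  let ?R = "gluing X \<union> (gluing X)\<inverse>"
  have "?R\<^sup>* `` {p} = ?R\<^sup>* `` {q}" if "(p, q) \<in> gluing X" for p q
  proof -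
    have "(p, q) \<in> ?R\<^sup>*" "(q, p) \<in> ?R\<^sup>*"
      using that by auto
    then show ?thesis
      by (auto intro: rtrancl_trans)
  qed
  then show "s \<in> squares X \<Longrightarrow> 0 \<le> y \<Longrightarrow> y \<le> 1 \<Longrightarrow> pt X s (1, y) = pt X (rgt X s) (0, y)"
    and "s \<in> squares X \<Longrightarrow> 0 \<le> x \<Longrightarrow> x \<le> 1 \<Longrightarrow> pt X s (x, 1) = pt X (upw X s) (x, 0)"
    unfolding pt_def by (blast | force simp: gluing_def)+
qed

text \<open>A gluing changes the intercept by \<open>\<alpha>\<close> across a vertical edge and by
  1 across a horizontal one, and \<open>special\<close> is stable under both. Genericity excludes
  the corners, where the two gluings would compete.\<close>

lemma gluing_generic:
  assumes "(p, q) \<in> gluing X"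
  shows "generic p = generic q" and "generic p \<Longrightarrow> normal_form p = normal_form q"
proof -
  have sh: "y - \<alpha> \<in> special \<longleftrightarrow> y \<in> special" "1 - \<alpha> * x \<in> special \<longleftrightarrow> - (\<alpha> * x) \<in> special" for x y
    using special_diff_slope[of y] special_add_int[of "- (\<alpha> * x)" 1] by auto
  have "1 - \<alpha> \<in> special" "- \<alpha> \<in> special"
    using special_diff_slope[of 1] special_diff_slope[of 0] one_special zero_special by simp_all
  with assms show "generic p = generic q" "generic p \<Longrightarrow> normal_form p = normal_form q"
    using sh one_special by (auto simp: gluing_def generic_def normal_form_def)
qed

text \<open>Both properties survive each single gluing, hence any chain of them. Equality of surface
  points can thus be unfolded to equality of normal forms.\<close>

lemma pt_eqD:
  assumes "pt X s z = pt X s' z'" and "generic (s, z)"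
  shows "generic (s', z')" and "normal_form (s, z) = normal_form (s', z')"
proof -
  have "((s, z), (s', z')) \<in> (gluing X \<union> (gluing X)\<inverse>)\<^sup>*"
    using assms(1) unfolding pt_def by blast
  then have "generic (s', z') \<and> normal_form (s, z) = normal_form (s', z')"
  proof (induction "(s', z')" arbitrary: s' z' rule: rtrancl_induct)
    case base
    then show ?case using assms by simp
  next
    case (step q s' z')
    then show ?case
      using gluing_generic by (cases q) (metis UnE converseD)
  qed
  then show "generic (s', z')" "normal_form (s, z) = normal_form (s', z')"
    by auto
qed

lemma pt_eq_interiorD:
  assumes "pt X s (x, y) = pt X s' z'" and "0 < x" "x < 1" "0 < y" "y < 1"
  shows "s' = s \<and> z' = (x, y)"
proof -
  have "((s, x, y), (s', z')) \<in> (gluing X \<union> (gluing X)\<inverse>)\<^sup>*"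
    using assms(1) unfolding pt_def by blast
  then show ?thesis
  proof (induction rule: converse_rtranclE)
    case (step q)
    then show ?case using assms by (auto simp: gluing_def)
  qed auto
qed

lemma generic_not_singular:
  assumes "generic (s, z)"
  shows "pt X s z \<notin> singularities X"
proof
  assume "pt X s z \<in> singularities X"
  then obtain s' where "pt X s z = pt X s' (1, 1)"
    by (auto simp: singularities_def)
  from pt_eqD(1)[OF this assms] show False
    using one_special special_diff_slope by (simp add: generic_def)
qed

text \<open>A barrier point also has the representative with \<open>x = 0\<close> in the square to
  the right; \<open>0 < x\<close> excludes it, in accordance with the barrier being
  one-sided.\<close>

lemma pt_eq_barrierD:
  assumes "pt X s (x, y) = pt X (bar X) (1, h)" and "generic (s, x, y)"
    and "s \<in> squares X" "0 < x" "x \<le> 1"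
  shows "s = bar X \<and> x = 1 \<and> y = h"
proof -
  have "normal_form (s, x, y) = (rgt X (bar X), 0, h)"
    using pt_eqD(2)[OF assms(1,2)] by (simp add: normal_form_def)
  moreover have "rgt X s = rgt X (bar X) \<longleftrightarrow> s = bar X"
    using assms(3) inj_on_eq_iff[OF bij_betw_imp_inj_on[OF bij_rgt]] bar_square by simp
  ultimately show ?thesis
    using assms(4) by (auto simp: normal_form_def split: if_splits)
qed

text \<open>
  The squares \<open>s\<close>, \<open>upw X s\<close>, \<open>upw X (upw X s)\<close>, \<dots> are stacked into a half-infinite column, with \<open>z \<ge> 0\<close>
  as height in the column.  \<open>hit s z\<close> is the point of a left edge from which the flow continues
  after it has met the right side of the column at height \<open>z\<close>.
\<close>

definition column :: "'s \<Rightarrow> real \<times> real \<Rightarrow> 's pt" where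
  "column s = (\<lambda>(x, z). pt X ((upw X ^^ nat \<lfloor>z\<rfloor>) s) (x, frac z))"

definition hit :: "'s \<Rightarrow> real \<Rightarrow> 's \<times> real" where
  "hit s z =
     (let s' = (upw X ^^ nat \<lfloor>z\<rfloor>) s in
      (if s' = bar X \<and> frac z \<in> heights X then rgt X (img X) else rgt X s', frac z))"

definition traverse :: "'s \<times> real \<Rightarrow> 's \<times> real" where
  "traverse = (\<lambda>(s, y). hit s (y + \<alpha>))"

abbreviation speed :: real where "speed \<equiv> sqrt (1 + \<alpha>\<^sup>2)"

lemma speed_pos: "0 < speed"
  by (simp add: add_pos_nonneg)

section \<open>Flow lines through a column of squares, up to the next vertical edge\<close>

lemma column_eq:
  assumes "of_nat k \<le> z" "z < of_nat k + 1"
  shows "column s (x, z) = pt X ((upw X ^^ k) s) (x, z - of_nat k)"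
proof -
  have "\<lfloor>z\<rfloor> = int k"
    using assms by (simp add: floor_eq_iff)
  then show ?thesis
    by (simp add: column_def frac_def)
qed

text \<open>At the top edge the two charts name the same point by the gluing. Including it lets a
  flow segment end there, and lets continuity be pasted from closed slabs.\<close>

lemma column_eq_closed:
  assumes "of_nat k \<le> z" "z \<le> of_nat k + 1" "s \<in> squares X" "0 \<le> x" "x \<le> 1"
  shows "column s (x, z) = pt X ((upw X ^^ k) s) (x, z - of_nat k)"
proof (cases "z = of_nat k + 1")
  case True
  then have "column s (x, z) = pt X ((upw X ^^ Suc k) s) (x, 0)"
    using column_eq[of "Suc k" z s x] by simp
  then show ?thesis
    using True pt_upw[of "(upw X ^^ k) s" x] assms upw_square by simp
next
  case False
  then show ?thesis
    using assms column_eq by auto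
qed

lemma floor_natE:
  fixes z :: real
  assumes "0 \<le> z"
  obtains k :: nat where "of_nat k \<le> z" "z < of_nat k + 1"
proof (rule that)
  have "real (nat \<lfloor>z\<rfloor>) = of_int \<lfloor>z\<rfloor>"
    using assms by simp
  then show "of_nat (nat \<lfloor>z\<rfloor>) \<le> z" "z < of_nat (nat \<lfloor>z\<rfloor>) + 1"
    by linarith+
qed

lemma generic_shift_square:
  assumes "z - \<alpha> * x \<notin> special"
  shows "generic (s, x, z - of_nat k)"
proof -
  have "z - of_nat k - \<alpha> * x = (z - \<alpha> * x) + of_int (- int k)"
    by simp
  then show ?thesis
    using assms special_add_int by (simp only: generic_def fst_conv snd_conv not_False_eq_True)
qed

text \<open>Concatenation of segments, one for each square of the column that is crossed. Since
  \<open>x' < 1\<close>, no segment ends on a vertical edge, so the barrier does not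
  interfere.\<close>

lemma flow_column:
  assumes "s \<in> squares X" "0 \<le> x" "x < x'" "x' < 1" "0 \<le> z" "z - \<alpha> * x \<notin> special"
  shows "flow X \<alpha> ((x' - x) * speed) (column s (x, z)) (column s (x', z + \<alpha> * (x' - x)))"
proof -
  \<comment> \<open>The line ends at most \<open>n\<close> squares above the square number
    \<open>k\<close>; the induction removes one square at a time.\<close>
  have *: "flow X \<alpha> ((x' - x) * speed) (column s (x, z)) (column s (x', z + \<alpha> * (x' - x)))"
    if "of_nat k \<le> z" "z < of_nat k + 1" "z + \<alpha> * (x' - x) \<le> of_nat (k + n) + 1"
      "0 \<le> x" "x < x'" "z - \<alpha> * x \<notin> special" for n k x z
    using that
  proof (induction n arbitrary: k x z)
    case 0
    let ?u = "(upw X ^^ k) s" and ?d = "x' - x"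
    have u: "?u \<in> squares X"
      using upw_square assms by simp
    have g: "generic (?u, x, z - of_nat k)"
      using 0 generic_shift_square by simp
    have g': "generic (?u, x + ?d, z - of_nat k + \<alpha> * ?d)"
      using g by (simp add: generic_def algebra_simps)
    have "flow X \<alpha> (?d * speed) (pt X ?u (x, z - of_nat k)) (pt X ?u (x + ?d, z - of_nat k + \<alpha> * ?d))"
    proof (rule flow_segment)
      show "pt X ?u (x + ?d, z - of_nat k + \<alpha> * ?d) \<notin> barrier X"
        using pt_eq_barrierD[OF _ g' u] 0 assms by (force simp: barrier_def)
    qed (use 0 assms u g g' generic_not_singular in auto)
    moreover have "0 < \<alpha> * ?d"
      using 0 slope_pos by simp
    ultimately show ?case
      using 0 assms column_eq_closed[of k "z + \<alpha> * ?d" s x'] column_eq[of k z s x]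
      by (simp add: algebra_simps)
  next
    case (Suc n)
    show ?case
    proof (cases "z + \<alpha> * (x' - x) \<le> of_nat (k + n) + 1")
      case True
      then show ?thesis using Suc by blast
    next
      case False
      \<comment> \<open>The abscissa at which the line reaches the top edge of the square number
        \<open>k\<close>.\<close>
      define x1 where "x1 = x + (of_nat k + 1 - z) / \<alpha>"
      have x1: "z + \<alpha> * (x1 - x) = of_nat k + 1"
        using slope_pos by (simp add: x1_def)
      have lt: "x < x1"
        using Suc.prems slope_pos by (simp add: x1_def)
      have "\<alpha> * (x1 - x) < \<alpha> * (x' - x)"
        using x1 False by simp
      then have lt': "x1 < x'"
        using slope_pos by simp
      let ?u = "(upw X ^^ k) s" and ?d = "x1 - x"
      have u: "?u \<in> squares X"
        using upw_square assms by simp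
      have g: "generic (?u, x, z - of_nat k)"
        using Suc.prems generic_shift_square by simp
      have g': "generic (?u, x + ?d, z - of_nat k + \<alpha> * ?d)"
        using g by (simp add: generic_def algebra_simps)
      have "flow X \<alpha> (?d * speed) (pt X ?u (x, z - of_nat k)) (pt X ?u (x + ?d, z - of_nat k + \<alpha> * ?d))"
      proof (rule flow_segment)
        show "pt X ?u (x + ?d, z - of_nat k + \<alpha> * ?d) \<notin> barrier X"
          using pt_eq_barrierD[OF _ g' u] Suc.prems lt lt' assms by (force simp: barrier_def)
      qed (use Suc.prems lt lt' x1 assms u g g' generic_not_singular in auto)
      moreover have "pt X ?u (x + ?d, z - of_nat k + \<alpha> * ?d) = column s (x1, of_nat k + 1)"
        using column_eq_closed[of k "of_nat k + 1" s x1] x1 lt lt' Suc.prems assms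
        by (simp add: algebra_simps)
      ultimately have "flow X \<alpha> ((x1 - x) * speed) (column s (x, z)) (column s (x1, of_nat k + 1))"
        using column_eq[of k z s x] Suc.prems by simp
      moreover have "flow X \<alpha> ((x' - x1) * speed) (column s (x1, of_nat k + 1))
           (column s (x', (of_nat k + 1) + \<alpha> * (x' - x1)))"
      proof (rule Suc.IH[of "Suc k"])
        show "of_nat k + 1 - \<alpha> * x1 \<notin> special"
          using x1 Suc.prems by (metis add_diff_cancel_right' add_diff_eq diff_add_eq right_diff_distrib)
        show "of_nat k + 1 + \<alpha> * (x' - x1) \<le> real (Suc k + n) + 1"
          using x1 Suc.prems by (simp add: algebra_simps)
      qed (use lt lt' Suc.prems in auto)
      ultimately have "flow X \<alpha> ((x1 - x) * speed + (x' - x1) * speed) (column s (x, z))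
           (column s (x', (of_nat k + 1) + \<alpha> * (x' - x1)))"
        by (rule flow_trans)
      moreover have "of_nat k + 1 + \<alpha> * (x' - x1) = z + \<alpha> * (x' - x)"
        using x1 by (simp add: algebra_simps)
      moreover have "(x1 - x) * speed + (x' - x1) * speed = (x' - x) * speed"
        by (simp add: algebra_simps)
      ultimately show ?thesis
        by simp
    qed
  qed
  obtain k :: nat where k: "of_nat k \<le> z" "z < of_nat k + 1"
    using floor_natE assms by blast
  obtain n :: nat where "z + \<alpha> * (x' - x) \<le> of_nat n"
    using real_arch_simple by blast
  then show ?thesis
    using *[of k z x n] k assms by simp
qed

definition edge :: "'s \<times> real \<Rightarrow> 's pt" where
  "edge = (\<lambda>(s, y). pt X s (0, y))"

definition edge_points :: "('s \<times> real) set" where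
  "edge_points = squares X \<times> ({0<..<1} - special)"

lemma edge_pointsD:
  assumes "(s, y) \<in> edge_points"
  shows "s \<in> squares X" "0 < y" "y < 1" "y \<notin> special"
  using assms by (auto simp: edge_points_def)

lemma edge_column: "0 \<le> y \<Longrightarrow> y < 1 \<Longrightarrow> edge (s, y) = column s (0, y)"
  using column_eq[of 0 y s 0] by (simp add: edge_def)

lemma hit_eq:
  assumes "of_nat k \<le> z" "z < of_nat k + 1"
  shows "hit s z = (if (upw X ^^ k) s = bar X \<and> z - of_nat k \<in> heights X then rgt X (img X)
                    else rgt X ((upw X ^^ k) s), z - of_nat k)"
proof -
  have "\<lfloor>z\<rfloor> = int k"
    using assms by (simp add: floor_eq_iff)
  then show ?thesis
    by (auto simp: hit_def frac_def Let_def)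
qed

lemma fst_hit_square: "s \<in> squares X \<Longrightarrow> fst (hit s z) \<in> squares X"
  by (simp add: hit_def Let_def rgt_square img_square upw_square)

lemma snd_hit: "snd (hit s z) = frac z"
  by (simp add: hit_def Let_def)

lemma hit_edge_point:
  assumes "s \<in> squares X" "z \<notin> special"
  shows "hit s z \<in> edge_points"
proof -
  have "frac z \<noteq> 0"
    using assms special_frac zero_special by metis
  then show ?thesis
    using assms special_frac fst_hit_square[of s z] frac_lt_1[of z] frac_ge_0[of z] snd_hit[of s z]
    by (cases "hit s z") (auto simp: edge_points_def)
qed

lemma traverse_edge_point: "p \<in> edge_points \<Longrightarrow> traverse p \<in> edge_points"
  using hit_edge_point special_add_slope by (cases p) (auto simp: traverse_def edge_points_def)

text \<open>The two cases correspond to the two flow rules. In both, the arrival point on a right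
  edge is renamed as a point of the left edge of the next square, as \<open>hit\<close>
  prescribes.\<close>

lemma flow_hit_segment:
  assumes "u \<in> squares X" "0 \<le> x" "x < 1" "0 \<le> y" "y + \<alpha> * (1 - x) < 1" "generic (u, x, y)"
  shows "flow X \<alpha> ((1 - x) * speed) (pt X u (x, y)) (edge (hit u (y + \<alpha> * (1 - x))))"
proof -
  let ?d = "1 - x"
  define h where "h = y + \<alpha> * ?d"
  have h: "0 \<le> h" "h < 1"
    using assms slope_pos by (auto simp: h_def)
  have g: "generic (u, 1, h)"
    using assms(6) by (simp add: generic_def h_def algebra_simps)
  have g': "generic (img X, 1, h)"
    using g by (simp add: generic_def)
  have hit: "hit u h = (if u = bar X \<and> h \<in> heights X then rgt X (img X) else rgt X u, h)"
    using hit_eq[of 0 h u] h by simp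
  show ?thesis
  proof (cases "u = bar X \<and> h \<in> heights X")
    case True
    have "flow X \<alpha> (?d * speed) (pt X u (x, y)) (pt X (img X) (1, h))"
      using assms h True g g' generic_not_singular
      by (intro flow_barrier) (auto simp: h_def)
    then show ?thesis
      using True hit h img_square pt_rgt unfolding h_def[symmetric] by (simp add: edge_def)
  next
    case False
    have "flow X \<alpha> (?d * speed) (pt X u (x, y)) (pt X u (x + ?d, y + \<alpha> * ?d))"
    proof (rule flow_segment)
      show "pt X u (x + ?d, y + \<alpha> * ?d) \<notin> barrier X"
        using pt_eq_barrierD[of u 1 h] g assms False by (auto simp: barrier_def h_def)
    qed (use assms g generic_not_singular in \<open>auto simp: h_def\<close>)
    then show ?thesis
      using False hit h assms pt_rgt unfolding h_def[symmetric] by (auto simp: edge_def)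
  qed
qed

lemma hit_upw:
  assumes "0 \<le> z"
  shows "hit ((upw X ^^ k) s) z = hit s (z + of_nat k)"
proof -
  obtain j :: nat where "of_nat j \<le> z" "z < of_nat j + 1"
    using floor_natE assms by blast
  then show ?thesis
    using hit_eq[of j z "(upw X ^^ k) s"] hit_eq[of "j + k" "z + of_nat k" s] by (simp add: funpow_add)
qed

lemma flow_hit:
  assumes "s \<in> squares X" "0 \<le> x" "x < 1" "0 \<le> z" "z - \<alpha> * x \<notin> special"
  shows "flow X \<alpha> ((1 - x) * speed) (column s (x, z)) (edge (hit s (z + \<alpha> * (1 - x))))"
proof -
  define z' where "z' = z + \<alpha> * (1 - x)"
  have z'_special: "z' \<notin> special"
    using assms(5) special_diff_slope[of z'] by (simp add: z'_def algebra_simps)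
  have "0 \<le> z'"
    using assms slope_pos by (simp add: z'_def)
  then obtain k :: nat where k: "of_nat k \<le> z'" "z' < of_nat k + 1"
    using floor_natE by blast
  have "z' \<noteq> of_nat k"
    using z'_special int_special[of "int k"] by auto
  with k have k': "of_nat k < z'"
    by simp
  \<comment> \<open>At abscissa \<open>x1\<close> the line is at least halfway up from the bottom
    edge of the square number \<open>k\<close> to the height \<open>z'\<close>, so the rest is a
    single segment in that square. If \<open>x1 = x\<close>, nothing precedes it.\<close>
  define x1 where "x1 = max x (1 - (z' - of_nat k) / (2 * \<alpha>))"
  define z1 where "z1 = z' - \<alpha> * (1 - x1)"
  have x1: "x \<le> x1" "x1 < 1" "1 - x1 \<le> (z' - of_nat k) / (2 * \<alpha>)"
    using assms slope_pos k' by (auto simp: x1_def)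
  have "\<alpha> * (1 - x1) \<le> \<alpha> * ((z' - of_nat k) / (2 * \<alpha>))"
    using x1(3) slope_pos by (intro mult_left_mono) auto
  also have "\<dots> = (z' - of_nat k) / 2"
    using slope_pos by simp
  finally have z1k: "of_nat k \<le> z1"
    using k' by (simp add: z1_def)
  have "0 < \<alpha> * (1 - x1)"
    using x1 slope_pos by simp
  then have z1k': "z1 < of_nat k + 1"
    using k by (simp add: z1_def)
  have z1: "z1 = z + \<alpha> * (x1 - x)"
    by (simp add: z1_def z'_def algebra_simps)
  let ?u = "(upw X ^^ k) s"
  have u: "?u \<in> squares X"
    using assms upw_square by simp
  have "z1 - \<alpha> * x1 \<notin> special"
    using assms(5) unfolding z1 by (simp add: algebra_simps)
  then have g: "generic (?u, x1, z1 - of_nat k)"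
    using generic_shift_square by simp
  have "flow X \<alpha> ((1 - x1) * speed) (pt X ?u (x1, z1 - of_nat k))
          (edge (hit ?u (z1 - of_nat k + \<alpha> * (1 - x1))))"
    using u assms x1 z1k g k by (intro flow_hit_segment) (auto simp: z1_def)
  moreover have "z1 - of_nat k + \<alpha> * (1 - x1) = z' - of_nat k"
    by (simp add: z1_def)
  ultimately have last: "flow X \<alpha> ((1 - x1) * speed) (column s (x1, z1)) (edge (hit s z'))"
    using column_eq[OF z1k z1k'] hit_upw[of "z' - of_nat k" k s] k by simp
  show ?thesis
  proof (cases "x1 = x")
    case True
    then show ?thesis
      using last z1 z'_def by simp
  next
    case False
    have "flow X \<alpha> ((x1 - x) * speed) (column s (x, z)) (column s (x1, z + \<alpha> * (x1 - x)))"
      using assms x1 False by (intro flow_column) auto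
    then have "flow X \<alpha> ((x1 - x) * speed + (1 - x1) * speed) (column s (x, z)) (edge (hit s z'))"
      using last z1 flow_trans by metis
    moreover have "(x1 - x) * speed + (1 - x1) * speed = (1 - x) * speed"
      by (simp add: algebra_simps)
    ultimately show ?thesis
      using z'_def by simp
  qed
qed

lemma flow_traverse:
  assumes "p \<in> edge_points"
  shows "flow X \<alpha> speed (edge p) (edge (traverse p))"
proof (cases p)
  case (Pair s y)
  then show ?thesis
    using assms flow_hit[of s 0 y] edge_column[of y s] edge_pointsD[of s y]
    by (simp add: traverse_def)
qed

lemma edge_surface:
  assumes "p \<in> edge_points"
  shows "edge p \<in> surface X" "edge p \<notin> singularities X"
proof -
  obtain s y where p: "p = (s, y)"
    by fastforce
  then have "generic (s, 0, y)"
    using assms by (simp add: generic_def edge_pointsD)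
  then show "edge p \<notin> singularities X"
    using generic_not_singular p by (simp add: edge_def)
  show "edge p \<in> surface X"
    using p edge_pointsD[of s y] assms
    by (fastforce simp: edge_def surface_def unit_square_def)
qed

section \<open>Regions swept out by points of the vertical edges\<close>

lemma flow_edge_column:
  assumes "(s, y) \<in> edge_points" "0 \<le> x" "x < 1"
  shows "flow X \<alpha> (x * speed) (edge (s, y)) (column s (x, y + \<alpha> * x))"
proof (cases "x = 0")
  case True
  then show ?thesis
    using flow_refl[OF edge_surface[OF assms(1)]] edge_column[of y s] edge_pointsD[OF assms(1)] by simp
next
  case False
  then show ?thesis
    using assms flow_column[of s 0 x y] edge_column[of y s] edge_pointsD[OF assms(1)] by simp
qed

text \<open>Half-open in \<open>x\<close>: the arrival point on the right side is not included by
  itself, but lies in the strip once \<open>traverse\<close> maps \<open>W\<close> into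
  itself.\<close>

definition strip :: "('s \<times> real) set \<Rightarrow> 's pt set" where
  "strip W = {column s (x, y + \<alpha> * x) | s y x. (s, y) \<in> W \<and> 0 \<le> x \<and> x < 1}"

lemma strip_mono: "W \<subseteq> W' \<Longrightarrow> strip W \<subseteq> strip W'"
  by (auto simp: strip_def)

lemma normal_form_id: "x \<noteq> 1 \<Longrightarrow> y \<noteq> 1 \<Longrightarrow> normal_form (s, x, y) = (s, x, y)"
  by (simp add: normal_form_def)

text \<open>A point of the strip determines its flow line backwards: because of \<open>x < 1\<close>
  and \<open>y < 1\<close> both representatives are their own normal forms, so they agree.
  \<open>k\<close> counts the horizontal edges crossed since the start.\<close>

lemma strip_cases:
  assumes "pt X s (x, y) \<in> strip W" "W \<subseteq> edge_points" "x < 1" "y < 1"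
  obtains s0 y0 k where "(s0, y0) \<in> W" "y0 + \<alpha> * x = y + of_nat k" "(upw X ^^ k) s0 = s"
    "0 \<le> x" "0 \<le> y"
proof -
  obtain s0 y0 x0 where *: "pt X s (x, y) = column s0 (x0, y0 + \<alpha> * x0)" "(s0, y0) \<in> W"
    "0 \<le> x0" "x0 < 1"
    using assms(1) by (auto simp: strip_def)
  have y0: "(s0, y0) \<in> edge_points"
    using * assms by auto
  then have "0 \<le> y0 + \<alpha> * x0"
    using * slope_pos edge_pointsD[OF y0] by simp
  then obtain k :: nat where k: "of_nat k \<le> y0 + \<alpha> * x0" "y0 + \<alpha> * x0 < of_nat k + 1"
    using floor_natE by blast
  let ?q = "((upw X ^^ k) s0, x0, y0 + \<alpha> * x0 - of_nat k)"
  have "generic ?q"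
    using edge_pointsD[OF y0] by (intro generic_shift_square) simp
  moreover have "pt X (fst ?q) (snd ?q) = pt X s (x, y)"
    using column_eq[OF k] * by simp
  ultimately have "normal_form ?q = normal_form (s, x, y)"
    using pt_eqD(2)[of "fst ?q" "snd ?q" s "(x, y)"] by simp
  then have "?q = (s, x, y)"
    using normal_form_id[of x0 "y0 + \<alpha> * x0 - of_nat k"] normal_form_id[of x y] *(4) k(2) assms(3,4)
    by (metis add.commute diff_less_eq less_irrefl)
  then show ?thesis
    using that[of s0 y0 k] * k by auto
qed

lemma strip_intro:
  assumes "(s0, y0) \<in> W" "y0 + \<alpha> * x = y + of_nat k" "0 \<le> x" "x < 1" "0 \<le> y" "y \<le> 1"
    "s0 \<in> squares X"
  shows "pt X ((upw X ^^ k) s0) (x, y) \<in> strip W"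
proof -
  have "pt X ((upw X ^^ k) s0) (x, y) = column s0 (x, y0 + \<alpha> * x)"
    using column_eq_closed[of k "y0 + \<alpha> * x" s0 x] assms by simp
  then show ?thesis
    unfolding strip_def using assms by blast
qed

lemma edge_strip:
  assumes "p \<in> W" "W \<subseteq> edge_points"
  shows "edge p \<in> strip W"
proof -
  obtain s y where p: "p = (s, y)"
    by fastforce
  then have "edge p = column s (0, y + \<alpha> * 0)"
    using assms edge_column[of y s] edge_pointsD[of s y] by auto
  then show ?thesis
    unfolding strip_def using p assms by fastforce
qed

text \<open>One flow segment, traced back to its start on the left side of the column. Genericity is
  inherited from there, so the segment cannot end in a corner; if it ends on the right side, the
  flow continues from the point given by \<open>traverse\<close> of the start.\<close>

lemma strip_segment:
  assumes W: "W \<subseteq> edge_points" "traverse ` W \<subseteq> W"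
    and s: "s \<in> squares X" "0 < d" "x + d \<le> 1" "y + \<alpha> * d \<le> 1"
    and P: "pt X s (x, y) \<in> strip W"
  shows "x + d < 1 \<Longrightarrow> pt X s (x + d, y + \<alpha> * d) \<in> strip W"
    and "x + d = 1 \<Longrightarrow> edge (hit s (y + \<alpha> * d)) \<in> strip W \<and> y + \<alpha> * d < 1 \<and> 0 \<le> y + \<alpha> * d"
    and "generic (s, x + d, y + \<alpha> * d)"
proof -
  have "0 < \<alpha> * d"
    using s slope_pos by simp
  then have "x < 1" "y < 1"
    using s by linarith+
  then obtain s0 y0 k where *: "(s0, y0) \<in> W" "y0 + \<alpha> * x = y + of_nat k" "(upw X ^^ k) s0 = s"
    "0 \<le> x" "0 \<le> y"
    using strip_cases[OF P W(1)] by blast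
  have e: "(s0, y0) \<in> edge_points"
    using * W by auto
  have end_eq: "y0 + \<alpha> * (x + d) = y + \<alpha> * d + of_nat k"
    using *(2) by (simp add: algebra_simps)
  have "y0 + \<alpha> * (x + d) - \<alpha> * (x + d) \<notin> special"
    using edge_pointsD[OF e] by simp
  then show g: "generic (s, x + d, y + \<alpha> * d)"
    using generic_shift_square[of "y0 + \<alpha> * (x + d)" "x + d" s k] end_eq by simp
  show "pt X s (x + d, y + \<alpha> * d) \<in> strip W" if "x + d < 1"
    using strip_intro[OF *(1) end_eq] * s that \<open>0 < \<alpha> * d\<close> edge_pointsD[OF e] by simp
  show "edge (hit s (y + \<alpha> * d)) \<in> strip W \<and> y + \<alpha> * d < 1 \<and> 0 \<le> y + \<alpha> * d" if "x + d = 1"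
  proof -
    have "y + \<alpha> * d - \<alpha> \<notin> special"
      using g unfolding that by (simp add: generic_def)
    then have "y + \<alpha> * d \<noteq> 1"
      using special_diff_slope[of 1] one_special by metis
    moreover have "hit s (y + \<alpha> * d) = traverse (s0, y0)"
      using hit_upw[of "y + \<alpha> * d" k s0] end_eq * that \<open>0 < \<alpha> * d\<close> by (simp add: traverse_def)
    moreover have "traverse (s0, y0) \<in> W"
      using W *(1) by blast
    ultimately show ?thesis
      using edge_strip[OF _ W(1)] * s \<open>0 < \<alpha> * d\<close> by simp
  qed
qed

lemma strip_flow_invariant:
  assumes W: "W \<subseteq> edge_points" "traverse ` W \<subseteq> W"
  shows "flow_invariant X \<alpha> (strip W)"
proof -
  have "Q \<in> strip W" if "flow X \<alpha> t P Q" "P \<in> strip W" for t P Q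
    using that
  proof (induction rule: flow.induct)
    case (flow_segment s x y d)
    show ?case
    proof (cases "x + d < 1")
      case True
      then show ?thesis
        using strip_segment(1)[OF W] flow_segment by blast
    next
      case False
      then have xd: "x + d = 1"
        using flow_segment by simp
      define h where "h = y + \<alpha> * d"
      have *: "edge (hit s h) \<in> strip W" "h < 1" "0 \<le> h"
        using strip_segment(2)[OF W flow_segment(1,4,5,6,10) xd] by (auto simp: h_def)
      have "\<not> (s = bar X \<and> h \<in> heights X)"
        using flow_segment xd by (auto simp: barrier_def h_def)
      then have "edge (hit s h) = pt X s (1, h)"
        using hit_eq[of 0 h s] * pt_rgt[of s h] flow_segment by (auto simp: edge_def)
      then show ?thesis
        using * xd by (simp add: h_def)
    qed
  next
    case (flow_barrier s x y d h)
    have g: "generic (s, x + d, y + \<alpha> * d)"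
      using strip_segment(3)[OF W] flow_barrier by blast
    have eq: "s = bar X" "x + d = 1" "y + \<alpha> * d = h"
      using pt_eq_barrierD[OF _ g, of h] flow_barrier by auto
    have *: "edge (hit s h) \<in> strip W" "h < 1" "0 \<le> h"
      using strip_segment(2)[OF W flow_barrier(1,4,5,6,12) eq(2)] eq by auto
    then have "edge (hit s h) = pt X (img X) (1, h)"
      using hit_eq[of 0 h s] pt_rgt[of "img X" h] img_square eq flow_barrier by (auto simp: edge_def)
    then show ?case
      using * by simp
  qed auto
  then show ?thesis
    by (auto simp: flow_invariant_def advance_def)
qed

lemma strip_interior_iff:
  assumes "W \<subseteq> edge_points" "0 < x" "x < 1" "0 < y" "y < 1"
  shows "pt X s (x, y) \<in> strip W \<longleftrightarrow>
    (\<exists>s0 y0 k. (s0, y0) \<in> W \<and> y0 + \<alpha> * x = y + of_nat k \<and> (upw X ^^ k) s0 = s)"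
proof
  assume "pt X s (x, y) \<in> strip W"
  then show "\<exists>s0 y0 k. (s0, y0) \<in> W \<and> y0 + \<alpha> * x = y + of_nat k \<and> (upw X ^^ k) s0 = s"
    by (rule strip_cases[OF _ assms(1,3,5)]) blast
next
  assume "\<exists>s0 y0 k. (s0, y0) \<in> W \<and> y0 + \<alpha> * x = y + of_nat k \<and> (upw X ^^ k) s0 = s"
  then obtain s0 y0 k where *: "(s0, y0) \<in> W" "y0 + \<alpha> * x = y + of_nat k" "(upw X ^^ k) s0 = s"
    by blast
  then show "pt X s (x, y) \<in> strip W"
    using strip_intro[OF *(1,2)] assms edge_pointsD(1)[of s0 y0] by auto
qed

text \<open>The starts of two lines through the same point have heights in \<open>(0,1)\<close> that
  differ by an integer, so the heights agree; injectivity of \<open>upw\<close> then gives the same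
  starting square.\<close>

lemma strip_disjoint:
  assumes W: "W \<subseteq> edge_points" "W' \<subseteq> edge_points" and "0 < x" "x < 1" "0 < y" "y < 1"
    and P: "pt X s (x, y) \<in> strip W" "pt X s (x, y) \<in> strip W'"
  shows "W \<inter> W' \<noteq> {}"
proof -
  obtain s0 y0 k where *: "(s0, y0) \<in> W" "y0 + \<alpha> * x = y + of_nat k" "(upw X ^^ k) s0 = s"
    using P(1) unfolding strip_interior_iff[OF W(1) assms(3-6)] by blast
  obtain s1 y1 j where **: "(s1, y1) \<in> W'" "y1 + \<alpha> * x = y + of_nat j" "(upw X ^^ j) s1 = s"
    using P(2) unfolding strip_interior_iff[OF W(2) assms(3-6)] by blast
  have e: "(s0, y0) \<in> edge_points" "(s1, y1) \<in> edge_points"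
    using * ** W by auto
  have "y0 - y1 = of_nat k - of_nat j"
    using * ** by linarith
  then have "\<bar>real k - real j\<bar> < 1"
    using edge_pointsD[OF e(1)] edge_pointsD[OF e(2)] by linarith
  then have "k = j"
    by linarith
  then have "y0 = y1" "s0 = s1"
    using * ** upw_inject edge_pointsD(1)[OF e(1)] edge_pointsD(1)[OF e(2)] by auto
  then show ?thesis
    using * ** by auto
qed

section \<open>Minimality of the component\<close>

definition exceptional :: "real set \<Rightarrow> (real \<times> real) set" where
  "exceptional Q = {z. fst z \<in> {0, 1} \<or> snd z \<in> {0, 1} \<or> snd z - \<alpha> * fst z \<in> Q}"

lemma negligible_exceptional:
  assumes "countable Q"
  shows "negligible (exceptional Q)"
proof -
  have "negligible {z. inner (- \<alpha>, 1 :: real) z = c}" "negligible {z. inner (1 :: real, 0 :: real) z = c}"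
    "negligible {z. inner (0 :: real, 1 :: real) z = c}" for c :: real
    using negligible_hyperplane[of "(- \<alpha>, 1 :: real)" c] negligible_hyperplane[of "(1, 0) :: real \<times> real" c]
      negligible_hyperplane[of "(0, 1) :: real \<times> real" c]
    by (simp_all add: zero_prod_def)
  then have neg: "negligible {z. snd z - \<alpha> * fst z = c}"
    "negligible {z :: real \<times> real. fst z = c}" "negligible {z :: real \<times> real. snd z = c}" for c :: real
    by (simp_all add: inner_prod_def algebra_simps)
  have "exceptional Q = {z. fst z = 0} \<union> {z. fst z = 1} \<union> {z. snd z = 0} \<union> {z. snd z = 1} \<union>
      (\<Union>c\<in>Q. {z. snd z - \<alpha> * fst z = c})"
    by (auto simp: exceptional_def)
  moreover have "negligible (\<Union>c\<in>Q. {z. snd z - \<alpha> * fst z = c})"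
    using neg assms by (intro negligible_countable_Union) auto
  ultimately show ?thesis
    using neg by auto
qed

lemma equal_aeI:
  assumes "\<And>s. s \<in> squares X \<Longrightarrow> countable (Q s)"
    and "\<And>s x y. \<lbrakk>s \<in> squares X; 0 < x; x < 1; 0 < y; y < 1; y - \<alpha> * x \<notin> Q s\<rbrakk>
       \<Longrightarrow> pt X s (x, y) \<in> A \<longleftrightarrow> pt X s (x, y) \<in> B"
  shows "equal_ae X A B"
  unfolding equal_ae_def surface_null_def
proof
  fix s assume s: "s \<in> squares X"
  have "in_square X (A - B \<union> (B - A)) s \<subseteq> exceptional (Q s)"
  proof
    fix z assume z: "z \<in> in_square X (A - B \<union> (B - A)) s"
    obtain x y where xy: "z = (x, y)"
      by fastforce
    then have "0 \<le> x" "x \<le> 1" "0 \<le> y" "y \<le> 1" "pt X s (x, y) \<in> A \<longleftrightarrow> pt X s (x, y) \<notin> B"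
      using z by (auto simp: in_square_def unit_square_def)
    then show "z \<in> exceptional (Q s)"
      using assms(2)[OF s, of x y] xy by (auto simp: exceptional_def less_le)
  qed
  then show "in_square X (A - B \<union> (B - A)) s \<in> null_sets lebesgue"
    using negligible_exceptional assms(1)[OF s] negligible_subset negligible_iff_null_sets by blast
qed

lemma column_surface:
  assumes "s \<in> squares X" "0 \<le> x" "x \<le> 1"
  shows "column s (x, z) \<in> surface X"
  using assms upw_square[of s] frac_lt_1[of z]
  by (auto simp: column_def surface_def unit_square_def less_imp_le intro!: bexI imageI)

lemma strip_surface: "W \<subseteq> edge_points \<Longrightarrow> strip W \<subseteq> surface X"
  by (force simp: strip_def edge_points_def intro: column_surface)

text \<open>Sort the points of the open square by starting square and number \<open>k\<close> of
  horizontal edges crossed: each class is the preimage of a section of \<open>W\<close> under a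
  continuous map. The other points lie on the edges of the square, and every subset of that null set
  is Lebesgue measurable.\<close>

lemma strip_measurable:
  assumes "W \<subseteq> edge_points" and W: "\<And>s. {y. (s, y) \<in> W} \<in> sets borel"
  shows "surface_measurable X (strip W)"
  unfolding surface_measurable_def
proof (intro conjI ballI)
  show "strip W \<subseteq> surface X"
    using strip_surface assms by simp
next
  fix s assume s: "s \<in> squares X"
  let ?B = "{0<..<1} \<times> {0<..<1} :: (real \<times> real) set"
  let ?f = "\<lambda>k z. snd z - \<alpha> * fst z + of_nat k :: real"
  let ?K = "\<lambda>s0. {k. (upw X ^^ k) s0 = s}"
  have "in_square X (strip W) s \<inter> ?B =
      (\<Union>s0\<in>squares X. \<Union>k\<in>?K s0. ?f k -` {y. (s0, y) \<in> W} \<inter> ?B)" (is "_ = ?M")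
  proof (intro set_eqI)
    fix z :: "real \<times> real"
    obtain x y where z: "z = (x, y)"
      by fastforce
    show "z \<in> in_square X (strip W) s \<inter> ?B \<longleftrightarrow> z \<in> ?M"
    proof (cases "z \<in> ?B")
      case True
      have "(\<exists>s0 y0 k. (s0, y0) \<in> W \<and> y0 + \<alpha> * x = y + of_nat k \<and> (upw X ^^ k) s0 = s) \<longleftrightarrow>
        (\<exists>s0\<in>squares X. \<exists>k. (upw X ^^ k) s0 = s \<and> (s0, y - \<alpha> * x + of_nat k) \<in> W)"
      proof -
        have eq: "y0 + \<alpha> * x = y + real k \<longleftrightarrow> y0 = y - \<alpha> * x + of_nat k" for y0 k
          by auto
        show ?thesis
          unfolding eq using assms(1) edge_pointsD(1) by blast
      qed
      then have "pt X s (x, y) \<in> strip W \<longleftrightarrow>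
        (\<exists>s0\<in>squares X. \<exists>k. (upw X ^^ k) s0 = s \<and> (s0, y - \<alpha> * x + of_nat k) \<in> W)"
        using strip_interior_iff[OF assms(1), of x y s] True z by simp
      moreover have "z \<in> in_square X (strip W) s \<longleftrightarrow> pt X s (x, y) \<in> strip W"
        using True z by (simp add: in_square_def unit_square_def)
      moreover have "z \<in> ?M \<longleftrightarrow>
        (\<exists>s0\<in>squares X. \<exists>k. (upw X ^^ k) s0 = s \<and> (s0, y - \<alpha> * x + of_nat k) \<in> W)"
        using True z by simp
      ultimately show ?thesis
        using True by simp
    qed auto
  qed
  moreover have "?M \<in> sets borel"
  proof -
    have "?f k -` {y. (s0, y) \<in> W} \<inter> ?B \<in> sets borel" for s0 k
    proof -
      have "?f k \<in> borel_measurable borel"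
        by (intro borel_measurable_continuous_onI continuous_intros)
      then have "?f k -` {y. (s0, y) \<in> W} \<in> sets borel"
        using W by (rule measurable_sets_borel)
      moreover have "?B \<in> sets borel"
        by (intro borel_open open_Times) auto
      ultimately show ?thesis
        by blast
    qed
    then show ?thesis
      by (intro sets.finite_UN[OF finite_squares] sets.countable_UN') auto
  qed
  ultimately have "in_square X (strip W) s \<inter> ?B \<in> sets lebesgue"
    by simp
  moreover have "in_square X (strip W) s - ?B \<subseteq> exceptional {}"
    by (auto simp: in_square_def unit_square_def exceptional_def less_le)
  then have "in_square X (strip W) s - ?B \<in> sets lebesgue"
    using negligible_subset[OF negligible_exceptional[of "{}"]] negligible_imp_sets by auto
  ultimately have "(in_square X (strip W) s \<inter> ?B) \<union> (in_square X (strip W) s - ?B) \<in> sets lebesgue"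
    by blast
  then show "in_square X (strip W) s \<in> sets lebesgue"
    by (simp add: Int_Diff_Un)
qed

text \<open>Apart from countably many lines, the strip contains a slanted open band of the square
  \<open>s\<close>, so it is enough that this band is nonempty.\<close>

lemma strip_interval_not_negligible:
  assumes W: "W \<subseteq> edge_points" and s: "s \<in> squares X" and ab: "0 \<le> a" "a < b" "b \<le> 1"
    and sub: "{s} \<times> ({a<..<b} - special) \<subseteq> W"
  shows "\<not> negligible (in_square X (strip W) s)"
proof
  assume *: "negligible (in_square X (strip W) s)"
  let ?U = "{z :: real \<times> real. fst z \<in> {0<..<1} \<and> snd z \<in> {0<..<1} \<and> snd z - \<alpha> * fst z \<in> {a<..<b}}"
  have "open ?U"
    unfolding greaterThanLessThan_iff
    by (intro open_Collect_conj open_Collect_less continuous_intros)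
  moreover have "?U \<noteq> {}"
  proof -
    define c where "c = (a + b) / 2"
    \<comment> \<open>Small enough that the line from height \<open>c\<close> has covered at most
      half of the distance to the top edge.\<close>
    define x where "x = min (1 / 2) ((1 - c) / (2 * \<alpha>))"
    have c: "0 < c" "c < 1" "a < c" "c < b"
      using ab by (auto simp: c_def)
    have x: "0 < x" "x < 1" "x \<le> (1 - c) / (2 * \<alpha>)"
      using c slope_pos by (auto simp: x_def)
    have "\<alpha> * x \<le> \<alpha> * ((1 - c) / (2 * \<alpha>))"
      using x slope_pos by (intro mult_left_mono) auto
    also have "\<dots> = (1 - c) / 2"
      using slope_pos by simp
    finally have "\<alpha> * x \<le> (1 - c) / 2" .
    moreover have "0 < \<alpha> * x"
      using x slope_pos by simp
    ultimately have "(x, c + \<alpha> * x) \<in> ?U"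
      using x c by auto
    then show ?thesis
      by blast
  qed
  moreover have "?U \<subseteq> in_square X (strip W) s \<union> exceptional special"
  proof
    fix z assume z: "z \<in> ?U"
    show "z \<in> in_square X (strip W) s \<union> exceptional special"
    proof (cases "snd z - \<alpha> * fst z \<in> special")
      case False
      then have "(s, snd z - \<alpha> * fst z) \<in> W"
        using z sub by auto
      then have "pt X ((upw X ^^ 0) s) (fst z, snd z) \<in> strip W"
        using z s by (intro strip_intro) auto
      then show ?thesis
        using z by (auto simp: in_square_def unit_square_def mem_Times_iff)
    qed (auto simp: exceptional_def)
  qed
  then have "negligible ?U"
    using negligible_subset[OF negligible_Un[OF * negligible_exceptional[OF countable_special]]] by simp
  ultimately show False
    using open_not_negligible by blast
qed

text \<open>The interval gives the strip positive area; it is measurable and flow-invariant, so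
  minimality forbids an area smaller than that of \<open>C\<close>. Since its area is finite, it can
  be cancelled and the difference is null.\<close>

lemma component_strip:
  assumes C: "recurrent_component X \<alpha> C"
    and W: "W \<subseteq> edge_points" "\<And>s. {y. (s, y) \<in> W} \<in> sets borel" "traverse ` W \<subseteq> W"
    and sub: "strip W \<subseteq> C"
    and interval: "s \<in> squares X" "0 \<le> a" "a < b" "b \<le> 1" "{s} \<times> ({a<..<b} - special) \<subseteq> W"
  shows "equal_ae X C (strip W)"
proof -
  let ?S = "in_square X (strip W)" and ?C = "in_square X C"
  have meas: "surface_measurable X (strip W)"
    using strip_measurable W by blast
  then have S_sets: "?S t \<in> sets lebesgue" if "t \<in> squares X" for t
    using that by (simp add: surface_measurable_def)
  have C_sets: "?C t \<in> sets lebesgue" if "t \<in> squares X" for t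
    using that C by (simp add: recurrent_component_def surface_measurable_def)
  have "emeasure lebesgue (?S s) \<noteq> 0"
    using strip_interval_not_negligible[OF W(1) interval] S_sets interval(1)
    by (auto simp: negligible_iff_null_sets null_sets_def)
  then have "0 < area X (strip W)"
    using interval(1) finite_squares by (auto simp: area_def zero_less_iff_neq_zero)
  moreover have inv: "flow_invariant X \<alpha> (strip W)"
    using strip_flow_invariant W by blast
  ultimately have "\<not> area X (strip W) < area X C"
    using C sub meas unfolding recurrent_component_def by blast
  moreover have SC: "?S t \<subseteq> ?C t" for t
    using sub by (auto simp: in_square_def)
  have diff: "in_square X (C - strip W) t = ?C t - ?S t" for t
    by (auto simp: in_square_def)
  have "area X C = (\<Sum>t\<in>squares X. emeasure lebesgue (?S t) + emeasure lebesgue (?C t - ?S t))"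
    unfolding area_def
  proof (intro sum.cong refl)
    fix t assume t: "t \<in> squares X"
    have "?S t \<union> (?C t - ?S t) = ?C t"
      using SC by blast
    then show "emeasure lebesgue (?C t) = emeasure lebesgue (?S t) + emeasure lebesgue (?C t - ?S t)"
      using plus_emeasure[of "?S t" lebesgue "?C t - ?S t"] S_sets[OF t] C_sets[OF t] by auto
  qed
  then have area_C: "area X C = area X (strip W) + area X (C - strip W)"
    by (simp add: area_def sum.distrib diff)
  moreover have "area X (strip W) < \<infinity>"
  proof -
    have "emeasure lebesgue (?S t) \<le> 1" for t
    proof -
      have "emeasure lebesgue (?S t) \<le> emeasure lebesgue (cbox (0 :: real, 0 :: real) (1, 1))"
      proof (intro emeasure_mono fmeasurableD)
        show "cbox (0 :: real, 0 :: real) (1, 1) \<in> lmeasurable"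
          by simp
      qed (auto simp: in_square_def unit_square_def cbox_Pair_eq)
      also have "\<dots> = ennreal (measure lborel (cbox (0 :: real, 0 :: real) (1, 1)))"
        using emeasure_eq_ennreal_measure[of lborel "cbox (0 :: real, 0 :: real) (1, 1)"]
          emeasure_lborel_cbox_finite[of "(0 :: real, 0 :: real)" "(1, 1)"] by simp
      finally show ?thesis
        by (simp add: content_Pair)
    qed
    then have "area X (strip W) \<le> (\<Sum>t\<in>squares X. 1)"
      unfolding area_def by (intro sum_mono)
    also have "\<dots> < \<infinity>"
      by (simp add: ennreal_of_nat_eq_real_of_nat)
    finally show ?thesis .
  qed
  ultimately have "area X (C - strip W) = 0"
    by (metis add.right_neutral ennreal_add_left_cancel_less infinity_ennreal_def less_irrefl not_gr_zero)
  then have "emeasure lebesgue (?C t - ?S t) = 0" if "t \<in> squares X" for t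
    using that finite_squares by (simp add: area_def diff)
  then have "?C t - ?S t \<in> null_sets lebesgue" if "t \<in> squares X" for t
    using that S_sets C_sets by (auto intro: null_setsI)
  moreover have "C - strip W \<union> (strip W - C) = C - strip W"
    using sub by auto
  ultimately show ?thesis
    by (simp add: equal_ae_def surface_null_def diff)
qed

text \<open>If the interval missed \<open>W\<close>, its strip would be disjoint from
  \<open>strip W\<close> inside the square and so lie in a null set, which it cannot. In this way
  equality almost everywhere on the surface is brought back to the edges.\<close>

lemma interval_meets:
  assumes C: "equal_ae X C (strip W)" and W: "W \<subseteq> edge_points"
    and interval: "s \<in> squares X" "0 \<le> a" "a < b" "b \<le> 1"
    and sub: "strip ({s} \<times> ({a<..<b} - special)) \<subseteq> C"
  obtains y where "a < y" "y < b" "y \<notin> special" "(s, y) \<in> W"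
proof -
  let ?J = "{s} \<times> ({a<..<b} - special)"
  have J: "?J \<subseteq> edge_points"
    using interval by (auto simp: edge_points_def)
  have "?J \<inter> W \<noteq> {}"
  proof
    assume empty: "?J \<inter> W = {}"
    have "in_square X (strip ?J) s \<subseteq> in_square X (C - strip W \<union> (strip W - C)) s \<union> exceptional {}"
    proof
      fix z assume z: "z \<in> in_square X (strip ?J) s"
      then have "z \<in> in_square X C s"
        using sub by (auto simp: in_square_def)
      moreover have "pt X s z \<notin> strip W" if "z \<notin> exceptional {}"
      proof -
        have "0 < fst z" "fst z < 1" "0 < snd z" "snd z < 1"
          using that z by (auto simp: in_square_def exceptional_def unit_square_def less_le)
        moreover have "pt X s (fst z, snd z) \<in> strip ?J"
          using z by (simp add: in_square_def)
        ultimately show ?thesis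
          using strip_disjoint[OF J W] empty by (metis prod.collapse)
      qed
      ultimately show "z \<in> in_square X (C - strip W \<union> (strip W - C)) s \<union> exceptional {}"
        by (auto simp: in_square_def)
    qed
    moreover have "negligible (in_square X (C - strip W \<union> (strip W - C)) s)"
      using C interval by (simp add: equal_ae_def surface_null_def negligible_iff_null_sets)
    ultimately have "negligible (in_square X (strip ?J) s)"
      using negligible_subset[OF negligible_Un] negligible_exceptional[of "{}"] by simp
    then show False
      using strip_interval_not_negligible[OF J interval] by blast
  qed
  then show ?thesis
    using that by auto
qed

end

section \<open>The return map to the vertical edges\<close>

lemma finite_separated:
  fixes R :: "real set"
  assumes "R \<subseteq> {0..1}" "0 < \<epsilon>" and sep: "\<And>f f'. f \<in> R \<Longrightarrow> f' \<in> R \<Longrightarrow> f < f' \<Longrightarrow> f + \<epsilon> \<le> f'"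
  shows "finite R"
proof (rule inj_on_finite)
  \<comment> \<open>Points at distance at least \<open>\<epsilon>\<close> fall into different cells
    of a grid of mesh \<open>\<epsilon>\<close>.\<close>
  have "\<lfloor>f / \<epsilon>\<rfloor> < \<lfloor>f' / \<epsilon>\<rfloor>" if "f \<in> R" "f' \<in> R" "f < f'" for f f'
  proof -
    have "(f + \<epsilon>) / \<epsilon> \<le> f' / \<epsilon>"
      using sep[OF that] assms(2) by (intro divide_right_mono) auto
    then have "f / \<epsilon> + 1 \<le> f' / \<epsilon>"
      using assms(2) by (simp add: add_divide_distrib)
    then show ?thesis
      by linarith
  qed
  then show "inj_on (\<lambda>f. \<lfloor>f / \<epsilon>\<rfloor>) R"
    by (intro linorder_inj_onI) (auto, force)
  have "\<lfloor>f / \<epsilon>\<rfloor> \<in> {0..\<lfloor>1 / \<epsilon>\<rfloor>}" if "f \<in> R" for f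
    using that assms(1,2) by (auto intro!: floor_mono divide_right_mono)
  then show "(\<lambda>f. \<lfloor>f / \<epsilon>\<rfloor>) ` R \<subseteq> {0..\<lfloor>1 / \<epsilon>\<rfloor>}"
    by blast
qed auto

text \<open>Every frontier point has a full interval of \<open>S\<close> of length
  \<open>\<epsilon>\<close> on its left or on its right. Two points with the same side are at least
  \<open>\<epsilon>\<close> apart, since the open set \<open>S\<close> contains none of its frontier
  points.\<close>

lemma finite_frontier_long_intervals:
  fixes S :: "real set"
  assumes S: "S \<subseteq> {0<..<1}" and "0 < \<epsilon>"
    and long: "\<And>y. y \<in> S \<Longrightarrow> \<exists>a b. a < y \<and> y < b \<and> \<epsilon> \<le> b - a \<and> {a<..<b} \<subseteq> S"
  shows "finite (frontier S)"
proof -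
  let ?F = "frontier S"
  let ?R = "{f \<in> ?F. {f<..<f + \<epsilon>} \<subseteq> S}" and ?L = "{f \<in> ?F. {f - \<epsilon><..<f} \<subseteq> S}"
  have "open S"
    unfolding open_subopen[of S]
  proof
    fix y assume "y \<in> S"
    from long[OF this] obtain a b where "y \<in> {a<..<b}" "{a<..<b} \<subseteq> S"
      by auto
    then show "\<exists>T. open T \<and> y \<in> T \<and> T \<subseteq> S"
      by (intro exI[of _ "{a<..<b}"]) auto
  qed
  then have F: "?F = closure S - S"
    by (simp add: frontier_def interior_open)
  have "closure S \<subseteq> {0..1}"
    using S by (intro closure_minimal) auto
  then have F01: "?F \<subseteq> {0..1}"
    using F by auto
  have "f \<in> ?R \<union> ?L" if f: "f \<in> ?F" for f
  proof (rule ccontr)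
    assume *: "f \<notin> ?R \<union> ?L"
    then have "\<not> {f<..<f + \<epsilon>} \<subseteq> S" "\<not> {f - \<epsilon><..<f} \<subseteq> S"
      using f by auto
    \<comment> \<open>Gaps of \<open>S\<close> on both sides of \<open>f\<close>, closer than
      \<open>\<epsilon>\<close>. A point \<open>y\<close> of \<open>S\<close> near \<open>f\<close>
      sits in an interval of \<open>S\<close> that avoids \<open>w\<close>, \<open>f\<close> and
      \<open>z\<close>, hence is shorter than \<open>\<epsilon>\<close>.\<close>
    then obtain z w where z: "f < z" "z < f + \<epsilon>" "z \<notin> S" and w: "f - \<epsilon> < w" "w < f" "w \<notin> S"
      by (meson greaterThanLessThan_iff subsetI)
    have "f \<in> closure S" "f \<notin> S"
      using f F by auto
    then obtain y where y: "y \<in> S" "\<bar>y - f\<bar> < min (z - f) (f - w)"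
      using z w unfolding closure_approachable dist_real_def by (metis diff_gt_0_iff_gt min_less_iff_conj)
    from long[OF y(1)] obtain a b where ab: "a < y" "y < b" "\<epsilon> \<le> b - a" "{a<..<b} \<subseteq> S"
      by blast
    have "f \<notin> {a<..<b}" "z \<notin> {a<..<b}" "w \<notin> {a<..<b}"
      using ab \<open>f \<notin> S\<close> z w by auto
    then show False
      using ab z w y by auto
  qed
  moreover have "finite ?R"
  proof (rule finite_separated[OF _ \<open>0 < \<epsilon>\<close>])
    fix f f' assume *: "f \<in> ?R" "f' \<in> ?R" "f < f'"
    then have "f' \<notin> {f<..<f + \<epsilon>}"
      using F by blast
    then show "f + \<epsilon> \<le> f'"
      using * by auto
  qed (use F01 in auto)
  moreover have "finite ?L"
  proof (rule finite_separated[OF _ \<open>0 < \<epsilon>\<close>])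
    fix f f' assume *: "f \<in> ?L" "f' \<in> ?L" "f < f'"
    then have "f \<notin> {f' - \<epsilon><..<f'}"
      using F by blast
    then show "f + \<epsilon> \<le> f'"
      using * by auto
  qed (use F01 in auto)
  ultimately show ?thesis
    using finite_subset[of ?F "?R \<union> ?L"] by blast
qed

text \<open>Openness for the discrete topology on the squares, without putting a topology on their
  type.\<close>

definition open_sections :: "('a \<times> real) set \<Rightarrow> bool" where
  "open_sections W \<longleftrightarrow> (\<forall>s. open {y. (s, y) \<in> W})"

lemma open_sectionsE:
  assumes "open_sections W" "(s, y) \<in> W"
  obtains e where "0 < e" "\<forall>y'. \<bar>y' - y\<bar> < e \<longrightarrow> (s, y') \<in> W"
  using assms unfolding open_sections_def open_dist dist_real_def by blast

lemma open_sectionsI: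
  assumes "\<And>s y. (s, y) \<in> W \<Longrightarrow> \<exists>e>0. \<forall>y'. \<bar>y' - y\<bar> < e \<longrightarrow> (s, y') \<in> W"
  shows "open_sections W"
  using assms unfolding open_sections_def open_dist dist_real_def by blast

lemma open_sections_UN: "(\<And>i. i \<in> A \<Longrightarrow> open_sections (W i)) \<Longrightarrow> open_sections (\<Union>i\<in>A. W i)"
  unfolding open_sections_def by (simp add: open_UN Collect_bex_eq)

section \<open>Discontinuities of the return map and images of open sets\<close>

context dissipative_flow
begin

text \<open>Only the heights at which \<open>hit\<close> can switch branch or square. Unlike the
  larger set \<open>special\<close> it is locally finite, so removing it from an open set leaves an
  open set.\<close>

definition jumps :: "real set" where
  "jumps = {z. frac z \<in> insert 0 (frontier (heights X))}"

lemma jumps_special: "z \<in> jumps \<Longrightarrow> z \<in> special"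
  using special_frac[of z] frontier_special zero_special unfolding jumps_def
  by (metis insertE mem_Collect_eq)

lemma finite_jumps: "finite (jumps \<inter> {a..b})"
proof (rule finite_subset)
  show "jumps \<inter> {a..b} \<subseteq> (\<lambda>(k, h). of_int k + h) ` ({\<lfloor>a\<rfloor>..\<lfloor>b\<rfloor>} \<times> insert 0 (frontier (heights X)))"
  proof
    fix z assume z: "z \<in> jumps \<inter> {a..b}"
    then have "(\<lfloor>z\<rfloor>, frac z) \<in> {\<lfloor>a\<rfloor>..\<lfloor>b\<rfloor>} \<times> insert 0 (frontier (heights X))"
      by (auto simp: jumps_def floor_mono)
    then show "z \<in> (\<lambda>(k, h). of_int k + h) ` ({\<lfloor>a\<rfloor>..\<lfloor>b\<rfloor>} \<times> insert 0 (frontier (heights X)))"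
      by (rule rev_image_eqI) (simp add: frac_def)
  qed
qed (use finite_frontier_heights in auto)

lemma jump_free_neighbourhood:
  assumes "z \<notin> jumps"
  obtains e where "0 < e" "{z - e<..<z + e} \<inter> jumps = {}"
proof -
  obtain d where d: "0 < d" "\<forall>x\<in>jumps \<inter> {z - 1..z + 1}. x \<noteq> z \<longrightarrow> d \<le> dist z x"
    using finite_set_avoid[OF finite_jumps] by blast
  show ?thesis
  proof (rule that[of "min d 1"])
    show "{z - min d 1<..<z + min d 1} \<inter> jumps = {}"
    proof (rule ccontr)
      assume "{z - min d 1<..<z + min d 1} \<inter> jumps \<noteq> {}"
      then obtain x where x: "x \<in> jumps" "z - min d 1 < x" "x < z + min d 1"
        by auto
      then have "x \<in> jumps \<inter> {z - 1..z + 1}" "x \<noteq> z"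
        using assms by auto
      then have "d \<le> \<bar>z - x\<bar>"
        using d by (auto simp: dist_real_def)
      then show False
        using x by (auto simp: abs_if split: if_splits)
    qed
  qed (use d in auto)
qed

text \<open>Heights without a jump between them have the same integer part and, by connectedness,
  the same membership in the barrier heights, so \<open>hit\<close> chooses the same edge.
  \<open>0 \<le> a\<close> keeps them where \<open>nat\<close> does not truncate.\<close>

lemma hit_translation:
  assumes "0 \<le> a" "{a<..<b} \<inter> jumps = {}" "y \<in> {a<..<b}" "y' \<in> {a<..<b}"
  shows "hit s y' = (fst (hit s y), snd (hit s y) + (y' - y))"
proof -
  have *: "hit s y' = (fst (hit s y), snd (hit s y) + (y' - y))"
    if y: "y \<in> {a<..<b}" "y' \<in> {a<..<b}" "y \<le> y'" for y y'
  proof -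
    obtain k :: nat where k: "of_nat k \<le> y" "y < of_nat k + 1"
      using floor_natE[of y] y assms by auto
    have no_jump: "z \<notin> jumps" if "y \<le> z" "z \<le> y'" for z
      using that assms(2) y by (auto simp: disjoint_iff)
    have "y' < of_nat k + 1"
    proof (rule ccontr)
      assume "\<not> y' < of_nat k + 1"
      moreover have "(of_nat k + 1 :: real) \<in> jumps"
        by (simp add: jumps_def frac_def)
      ultimately show False
        using no_jump[of "of_nat k + 1"] k by simp
    qed
    then have hit: "hit s z = (if (upw X ^^ k) s = bar X \<and> z - of_nat k \<in> heights X then rgt X (img X)
                    else rgt X ((upw X ^^ k) s), z - of_nat k)" if "y \<le> z" "z \<le> y'" for z
      using hit_eq[of k z s] k that by auto
    have "y - of_nat k \<in> heights X \<longleftrightarrow> y' - of_nat k \<in> heights X"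
    proof (rule ccontr)
      let ?S = "{y - of_nat k..y' - of_nat k}"
      assume "\<not> ?thesis"
      moreover have "y - of_nat k \<in> ?S" "y' - of_nat k \<in> ?S"
        using y by auto
      ultimately have "?S \<inter> frontier (heights X) \<noteq> {}"
        by (intro connected_Int_frontier) (blast | simp)+
      then obtain h where h: "h \<in> ?S" "h \<in> frontier (heights X)"
        by blast
      then have "frac (h + of_nat k) = h"
        using k \<open>y' < of_nat k + 1\<close> by (auto simp: frac_unique_iff)
      then have "h + of_nat k \<in> jumps"
        using h by (simp add: jumps_def)
      then show False
        using no_jump[of "h + of_nat k"] h by simp
    qed
    then show ?thesis
      using hit[of y] hit[of y'] y by simp
  qed
  show ?thesis
  proof (cases "y \<le> y'")
    case False
    then show ?thesis
      using *[of y' y] assms(3,4) by simp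
  next
    case True
    then show ?thesis
      using *[of y y'] assms(3,4) by simp
  qed
qed

definition hits :: "('s \<times> real) set \<Rightarrow> ('s \<times> real) set" where
  "hits W = {hit s z | s z. (s, z) \<in> W \<and> z \<notin> jumps}"

lemma open_hits:
  assumes "open_sections W" "W \<subseteq> UNIV \<times> {0<..}"
  shows "open_sections (hits W)"
proof (rule open_sectionsI)
  fix s' y' assume "(s', y') \<in> hits W"
  then obtain s z where sz: "(s', y') = hit s z" "(s, z) \<in> W" "z \<notin> jumps"
    by (auto simp: hits_def)
  obtain e where e: "0 < e" "\<forall>w. \<bar>w - z\<bar> < e \<longrightarrow> (s, w) \<in> W"
    by (rule open_sectionsE[OF assms(1) sz(2)])
  obtain d where d: "0 < d" "{z - d<..<z + d} \<inter> jumps = {}"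
    using jump_free_neighbourhood[OF sz(3)] by blast
  \<comment> \<open>At most \<open>e\<close> to stay in \<open>W\<close>, at most \<open>d\<close>
    to avoid jumps, and at most \<open>z\<close> to stay at nonnegative heights.\<close>
  define r where "r = min (min e d) z"
  have "0 < z"
    using sz(2) assms(2) by auto
  then have r: "0 < r" "r \<le> e" "r \<le> z" "r \<le> d"
    using e(1) d(1) by (auto simp: r_def)
  then have "{z - r<..<z + r} \<subseteq> {z - d<..<z + d}"
    by auto
  with d(2) r have r: "0 < r" "r \<le> e" "r \<le> z" "{z - r<..<z + r} \<inter> jumps = {}"
    by blast+
  have "(s', w) \<in> hits W" if "\<bar>w - y'\<bar> < r" for w
  proof -
    let ?v = "z + (w - y')"
    have v: "?v \<in> {z - r<..<z + r}"
      using that by (auto simp: abs_less_iff)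
    have "hit s ?v = (s', y' + (w - y'))"
      using hit_translation[of "z - r" "z + r" z ?v s] r v sz(1)[symmetric] by simp
    moreover have "(s, ?v) \<in> W" "?v \<notin> jumps"
      using e(2)[rule_format, of ?v] that r(2,4) v by (auto simp: disjoint_iff)
    ultimately show ?thesis
      unfolding hits_def by force
  qed
  then show "\<exists>e>0. \<forall>w. \<bar>w - y'\<bar> < e \<longrightarrow> (s', w) \<in> hits W"
    using r(1) by blast
qed

text \<open>The return map on sets. Omitting the jumps keeps images open, and no generic point is
  lost, as \<open>jumps\<close> lies in \<open>special\<close>.\<close>

definition push :: "('s \<times> real) set \<Rightarrow> ('s \<times> real) set" where
  "push W = {traverse (s, y) | s y. (s, y) \<in> W \<and> y + \<alpha> \<notin> jumps}"

abbreviation edges :: "('s \<times> real) set" where "edges \<equiv> squares X \<times> {0<..<1}"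

lemma push_hits: "push W = hits {(s, z). (s, z - \<alpha>) \<in> W}"
proof (intro equalityI subsetI)
  fix p assume "p \<in> push W"
  then obtain s y where "p = hit s (y + \<alpha>)" "(s, y) \<in> W" "y + \<alpha> \<notin> jumps"
    by (auto simp: push_def traverse_def)
  then show "p \<in> hits {(s, z). (s, z - \<alpha>) \<in> W}"
    unfolding hits_def by force
next
  fix p assume "p \<in> hits {(s, z). (s, z - \<alpha>) \<in> W}"
  then obtain s z where "p = hit s z" "(s, z - \<alpha>) \<in> W" "z \<notin> jumps"
    by (auto simp: hits_def)
  then have "p = traverse (s, z - \<alpha>)" "(s, z - \<alpha>) \<in> W" "z - \<alpha> + \<alpha> \<notin> jumps"
    by (auto simp: traverse_def)
  then show "p \<in> push W"
    unfolding push_def by blast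
qed

lemma open_push:
  assumes "open_sections W" "W \<subseteq> edges"
  shows "open_sections (push W)"
  unfolding push_hits
proof (rule open_hits)
  show "open_sections {(s, z). (s, z - \<alpha>) \<in> W}"
  proof (rule open_sectionsI)
    fix s z assume "(s, z) \<in> {(s, z). (s, z - \<alpha>) \<in> W}"
    then have "(s, z - \<alpha>) \<in> W"
      by simp
    then obtain e where e: "0 < e" "\<forall>y'. \<bar>y' - (z - \<alpha>)\<bar> < e \<longrightarrow> (s, y') \<in> W"
      by (rule open_sectionsE[OF assms(1)])
    then show "\<exists>e>0. \<forall>z'. \<bar>z' - z\<bar> < e \<longrightarrow> (s, z') \<in> {(s, z). (s, z - \<alpha>) \<in> W}"
      by (intro exI[of _ e]) simp
  qed
  show "{(s, z). (s, z - \<alpha>) \<in> W} \<subseteq> UNIV \<times> {0<..}"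
    using assms(2) slope_pos by force
qed

lemma hits_edges: "W \<subseteq> squares X \<times> UNIV \<Longrightarrow> hits W \<subseteq> edges"
proof
  fix p assume W: "W \<subseteq> squares X \<times> UNIV" and "p \<in> hits W"
  then obtain s z where p: "p = hit s z" "(s, z) \<in> W" "z \<notin> jumps"
    by (auto simp: hits_def)
  then have "frac z \<noteq> 0"
    by (simp add: jumps_def)
  then have "snd p \<in> {0<..<1}"
    using p snd_hit[of s z] frac_ge_0[of z] frac_lt_1[of z] by (auto simp: less_le)
  moreover have "fst p \<in> squares X"
    using p W fst_hit_square by auto
  ultimately show "p \<in> edges"
    by (cases p) auto
qed

lemma push_edges: "W \<subseteq> edges \<Longrightarrow> push W \<subseteq> edges"
  unfolding push_hits by (rule hits_edges) auto

lemma push_mono: "W \<subseteq> W' \<Longrightarrow> push W \<subseteq> push W'"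
  by (auto simp: push_def)

lemma push_pow_mono: "W \<subseteq> W' \<Longrightarrow> (push ^^ n) W \<subseteq> (push ^^ n) W'"
  by (induction n) (simp_all add: push_mono)

lemma push_pow_edges: "W \<subseteq> edges \<Longrightarrow> (push ^^ n) W \<subseteq> edges"
  by (induction n) (simp_all add: push_edges)

lemma open_push_pow: "open_sections W \<Longrightarrow> W \<subseteq> edges \<Longrightarrow> open_sections ((push ^^ n) W)"
  by (induction n) (simp_all add: open_push push_pow_edges)

lemma push_UN: "push (\<Union>i\<in>A. W i) = (\<Union>i\<in>A. push (W i))"
  by (auto simp: push_def)

lemma open_sections_generic:
  assumes "open_sections W" "p \<in> W"
  obtains s y where "(s, y) \<in> W" "y \<notin> special"
proof -
  obtain s y where p: "p = (s, y)"
    by fastforce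
  then have "(s, y) \<in> W"
    using assms(2) by simp
  then obtain e where e: "0 < e" "\<forall>y'. \<bar>y' - y\<bar> < e \<longrightarrow> (s, y') \<in> W"
    by (rule open_sectionsE[OF assms(1)])
  have "uncountable {y - e<..<y + e}"
    using e by (simp add: uncountable_open_interval)
  then obtain y' where "y' \<in> {y - e<..<y + e}" "y' \<notin> special"
    using countable_subset[OF _ countable_special] by (metis subsetI)
  then show ?thesis
    using that[of s y'] e(2)[rule_format, of y'] by (auto simp: abs_less_iff)
qed

lemma push_nonempty:
  assumes "open_sections W" "W \<noteq> {}"
  shows "push W \<noteq> {}"
proof -
  obtain s y where "(s, y) \<in> W" "y \<notin> special"
    using open_sections_generic assms by blast
  then have "traverse (s, y) \<in> push W"
    using jumps_special special_add_slope unfolding push_def by blast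
  then show ?thesis
    by blast
qed

lemma push_pow_nonempty:
  assumes "open_sections W" "W \<subseteq> edges" "W \<noteq> {}"
  shows "(push ^^ n) W \<noteq> {}"
  using assms by (induction n) (simp_all add: push_nonempty open_push_pow)

text \<open>The passage from open sets to generic points, on which \<open>push\<close> and
  \<open>traverse\<close> have the same effect.\<close>

lemma traverse_push:
  assumes "push W \<subseteq> W"
  shows "traverse ` (W \<inter> edge_points) \<subseteq> W \<inter> edge_points"
proof
  fix q assume "q \<in> traverse ` (W \<inter> edge_points)"
  then obtain s y where q: "q = traverse (s, y)" "(s, y) \<in> W" "(s, y) \<in> edge_points"
    by auto
  then have "q \<in> push W"
    using jumps_special special_add_slope edge_pointsD unfolding push_def by blast
  then show "q \<in> W \<inter> edge_points"
    using q assms traverse_edge_point by blast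
qed

text \<open>Take a vertical segment of \<open>G\<close> inside an open square and follow it to the
  right side. All its points have the same abscissa, so they need the same time.\<close>

lemma open_set_reaches_edges:
  assumes "openin (surface_topology X) G" "G \<noteq> {}"
  obtains I t where "0 \<le> t" "open_sections I" "I \<subseteq> edges" "I \<noteq> {}"
    "\<forall>p\<in>I \<inter> edge_points. edge p \<in> advance X \<alpha> t G"
proof -
  obtain P where "P \<in> G"
    using assms by blast
  then have "P \<in> surface X"
    using assms by (auto simp: openin_surface_topology surface_open_def)
  then obtain s z where s: "s \<in> squares X" "z \<in> in_square X G s"
    using \<open>P \<in> G\<close> by (auto simp: surface_def in_square_def)
  then have "openin (top_of_set unit_square) (in_square X G s)"
    using assms by (simp add: openin_surface_topology surface_open_def)
  then obtain T where T: "open T" "in_square X G s = unit_square \<inter> T"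
    by (auto simp: openin_open)
  let ?B = "{0<..<1} \<times> {0<..<1} :: (real \<times> real) set"
  \<comment> \<open>\<open>G\<close> is open in the chart only relative to the closed square, and
    \<open>z\<close> may lie on an edge; a point of the open square is found nearby.\<close>
  have "z \<in> closure ?B"
    using s by (simp add: closure_Times in_square_def unit_square_def)
  then have "T \<inter> ?B \<noteq> {}"
    using T s(2) open_Int_closure_eq_empty[of T ?B] by blast
  then obtain w where w: "w \<in> T \<inter> ?B"
    by blast
  have "open (T \<inter> ?B)"
    using T by (intro open_Int open_Times) auto
  then obtain A B where AB: "open A" "open B" "w \<in> A \<times> B" "A \<times> B \<subseteq> T \<inter> ?B"
    using w by (rule open_prod_elim)
  define x where "x = fst w"
  have x: "0 < x" "x < 1"
    using w by (auto simp: x_def mem_Times_iff)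
  have B: "0 < y" "y < 1" "pt X s (x, y) \<in> G" if "y \<in> B" for y
  proof -
    have "(x, y) \<in> T \<inter> ?B"
      using AB that by (auto simp: x_def mem_Times_iff)
    moreover from this have "(x, y) \<in> in_square X G s"
      unfolding T(2) by (auto simp: unit_square_def)
    ultimately show "0 < y" "y < 1" "pt X s (x, y) \<in> G"
      by (auto simp: in_square_def)
  qed
  \<comment> \<open>The heights at which the lines from the segment meet the right side: each
    starting height is raised by \<open>\<alpha> * (1 - x)\<close>.\<close>
  define W where "W = {(s', z). s' = s \<and> z - \<alpha> * (1 - x) \<in> B}"
  define I where "I = hits W"
  have W: "open_sections W"
  proof -
    have "open ((\<lambda>z. z - \<alpha> * (1 - x)) -` B)"
      by (intro open_vimage AB continuous_intros)
    moreover have "{z. (s', z) \<in> W} = (if s' = s then (\<lambda>z. z - \<alpha> * (1 - x)) -` B else {})" for s'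
      by (auto simp: W_def)
    ultimately show ?thesis
      by (simp add: open_sections_def)
  qed
  have pos: "0 < \<alpha> * (1 - x)"
    using slope_pos x by simp
  have "open_sections I"
    unfolding I_def
  proof (rule open_hits[OF W])
    show "W \<subseteq> UNIV \<times> {0<..}"
      using B(1) pos by (force simp: W_def)
  qed
  moreover have "I \<subseteq> edges"
    unfolding I_def using s by (intro hits_edges) (auto simp: W_def)
  moreover have "I \<noteq> {}"
  proof -
    have "(s, snd w + \<alpha> * (1 - x)) \<in> W"
      using AB by (auto simp: W_def mem_Times_iff)
    then obtain s' z where z: "(s', z) \<in> W" "z \<notin> special"
      by (rule open_sections_generic[OF W])
    then have "hit s' z \<in> I"
      using jumps_special unfolding I_def hits_def by blast
    then show ?thesis
      by blast
  qed
  moreover have "edge p \<in> advance X \<alpha> ((1 - x) * speed) G" if p: "p \<in> I \<inter> edge_points" for p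
  proof -
    obtain z where z: "p = hit s z" "z - \<alpha> * (1 - x) \<in> B"
      using p by (auto simp: I_def hits_def W_def)
    define y where "y = z - \<alpha> * (1 - x)"
    have "snd p \<notin> special"
      using p edge_pointsD(4)[of "fst p" "snd p"] by simp
    then have "z \<notin> special"
      using z snd_hit[of s z] special_frac by metis
    moreover have "y - \<alpha> * x = z - \<alpha>"
      by (simp add: y_def algebra_simps)
    ultimately have "y - \<alpha> * x \<notin> special"
      using special_diff_slope by simp
    moreover have "column s (x, y) = pt X s (x, y)"
      using column_eq[of 0 y s x] B[of y] z by (simp add: y_def)
    ultimately have "flow X \<alpha> ((1 - x) * speed) (pt X s (x, y)) (edge p)"
      using flow_hit[of s x y] s x B[of y] z by (simp add: y_def)
    then show ?thesis
      using B(3)[of y] z by (auto simp: advance_def y_def)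
  qed
  ultimately show ?thesis
    using that[of "(1 - x) * speed" I] x speed_pos by simp
qed

end

section \<open>The forward orbit of an open set of edge points reached from \<open>G\<close>\<close>

locale open_component = dissipative_flow X \<alpha>
  for X :: "'s barrier_system" and \<alpha> :: real +
  fixes C G :: "'s pt set" and I :: "('s \<times> real) set" and t0 :: real
  assumes irrational: "\<alpha> \<notin> \<rat>"
    and component: "recurrent_component X \<alpha> C"
    and G_sub: "G \<subseteq> C"
    and time: "0 \<le> t0"
    and I_open: "open_sections I" and I_edges: "I \<subseteq> edges" and I_nonempty: "I \<noteq> {}"
    and I_reached: "\<And>p. p \<in> I \<inter> edge_points \<Longrightarrow> edge p \<in> advance X \<alpha> t0 G"
begin

definition reached :: "nat \<Rightarrow> ('s \<times> real) set" where
  "reached k = (\<Union>n\<in>{..k}. (push ^^ n) I)"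

definition orbit :: "('s \<times> real) set" where
  "orbit = (\<Union>n. (push ^^ n) I)"

lemma reached_orbit: "reached k \<subseteq> orbit"
  by (auto simp: reached_def orbit_def)

lemma orbit_reached: "orbit = (\<Union>k. reached k)"
  by (auto simp: reached_def orbit_def)

lemma reached_mono: "k \<le> k' \<Longrightarrow> reached k \<subseteq> reached k'"
  unfolding reached_def by (intro UN_mono) auto

lemma push_reached: "push (reached k) \<subseteq> reached (Suc k)"
  unfolding reached_def push_UN by (force intro: bexI[of _ "Suc _"])

lemma push_orbit: "push orbit \<subseteq> orbit"
  unfolding orbit_def push_UN by (force intro: exI[of _ "Suc _"])

lemma orbit_edges: "orbit \<subseteq> edges"
  using push_pow_edges[OF I_edges] by (auto simp: orbit_def)

lemma orbit_open: "open_sections orbit" and reached_open: "open_sections (reached k)"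
  unfolding orbit_def reached_def using open_push_pow I_open I_edges by (auto intro: open_sections_UN)

lemma I_orbit: "I \<subseteq> orbit"
  unfolding orbit_def by (force intro: exI[of _ 0])

lemma push_pow_flow:
  "p \<in> (push ^^ n) I \<inter> edge_points \<Longrightarrow> edge p \<in> advance X \<alpha> (t0 + of_nat n * speed) G"
proof (induction n arbitrary: p)
  case 0
  then show ?case using I_reached by simp
next
  case (Suc n)
  then have "p \<in> push ((push ^^ n) I)"
    by simp
  then obtain s y where p: "p = traverse (s, y)" "(s, y) \<in> (push ^^ n) I"
    unfolding push_def[of "(push ^^ n) I"] by blast
  have "(s, y) \<in> edges"
    using p(2) push_pow_edges[OF I_edges] by blast
  then have sy: "s \<in> squares X" "0 < y" "y < 1"
    by auto
  \<comment> \<open>The return map changes heights by \<open>\<alpha>\<close> modulo 1, so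
    genericity passes back from the image to the preimage \<open>(s, y)\<close>.\<close>
  have "snd p \<notin> special"
    using Suc.prems edge_pointsD(4)[of "fst p" "snd p"] by simp
  then have "y \<notin> special"
    using p special_frac special_add_slope by (simp add: traverse_def snd_hit)
  then have e: "(s, y) \<in> edge_points"
    using sy by (simp add: edge_points_def)
  then obtain P where P: "P \<in> G" "flow X \<alpha> (t0 + of_nat n * speed) P (edge (s, y))"
    using Suc.IH[of "(s, y)"] p by (auto simp: advance_def)
  have "flow X \<alpha> (t0 + of_nat n * speed + speed) P (edge p)"
    using flow_trans[OF P(2) flow_traverse[OF e]] p by simp
  then show ?case
    using P by (auto simp: advance_def algebra_simps)
qed

lemma strip_reached:
  "strip (reached k \<inter> edge_points) \<subseteq> (\<Union>t\<in>{0..t0 + (of_nat k + 1) * speed}. advance X \<alpha> t G)"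
proof
  fix Q assume "Q \<in> strip (reached k \<inter> edge_points)"
  then obtain s y x n where Q: "Q = column s (x, y + \<alpha> * x)" "0 \<le> x" "x < 1"
    "(s, y) \<in> edge_points" "(s, y) \<in> (push ^^ n) I" "n \<le> k"
    by (auto simp: strip_def reached_def)
  obtain P where P: "P \<in> G" "flow X \<alpha> (t0 + of_nat n * speed) P (edge (s, y))"
    using push_pow_flow[of "(s, y)" n] Q by (auto simp: advance_def)
  \<comment> \<open>Time \<open>t0\<close> to reach \<open>I\<close>, then \<open>n\<close> full
    traverses, then the fraction \<open>x < 1\<close> of one more.\<close>
  let ?t = "t0 + of_nat n * speed + x * speed"
  have "flow X \<alpha> ?t P Q"
    using flow_trans[OF P(2) flow_edge_column] Q by simp
  moreover have "(of_nat n + x) * speed \<le> (of_nat k + 1) * speed" "0 \<le> (of_nat n + x) * speed"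
    using Q speed_pos by (auto intro!: mult_right_mono add_mono)
  then have "?t \<in> {0..t0 + (of_nat k + 1) * speed}"
    using time by (auto simp: algebra_simps)
  moreover from calculation have "Q \<in> advance X \<alpha> ?t G"
    using P(1) unfolding advance_def by blast
  ultimately show "Q \<in> (\<Union>t\<in>{0..t0 + (of_nat k + 1) * speed}. advance X \<alpha> t G)"
    by (intro UN_I)
qed

lemma advance_G: "0 \<le> t \<Longrightarrow> advance X \<alpha> t G \<subseteq> C"
  using component G_sub unfolding recurrent_component_def flow_invariant_def advance_def by blast

lemma strip_orbit: "W \<subseteq> orbit \<Longrightarrow> strip (W \<inter> edge_points) \<subseteq> C"
proof
  fix Q assume "W \<subseteq> orbit" "Q \<in> strip (W \<inter> edge_points)"
  then obtain k where "Q \<in> strip (reached k \<inter> edge_points)"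
    unfolding orbit_reached strip_def by blast
  then obtain t where "t \<in> {0..t0 + (of_nat k + 1) * speed}" "Q \<in> advance X \<alpha> t G"
    using strip_reached[of k] by blast
  then show "Q \<in> C"
    using advance_G[of t] by auto
qed

text \<open>The form in which minimality is used; it is applied to the orbit, to its long intervals
  and to an iterated image of it. Positive area comes from a small interval in the open set
  \<open>W\<close>.\<close>

lemma component_open_strip:
  assumes W: "open_sections W" "W \<subseteq> orbit" "W \<noteq> {}" "push W \<subseteq> W"
  shows "equal_ae X C (strip (W \<inter> edge_points))"
proof -
  obtain s y where sy: "(s, y) \<in> W"
    using W(3) by fastforce
  then obtain e where e: "0 < e" "\<forall>y'. \<bar>y' - y\<bar> < e \<longrightarrow> (s, y') \<in> W"
    by (rule open_sectionsE[OF W(1)])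
  have "(s, y) \<in> edges"
    using sy W(2) orbit_edges by blast
  then have y: "s \<in> squares X" "0 < y" "y < 1"
    by auto
  define a b where "a = max 0 (y - e)" and "b = min 1 (y + e)"
  show ?thesis
  proof (rule component_strip[OF component])
    show "strip (W \<inter> edge_points) \<subseteq> C"
      using strip_orbit W by blast
    show "traverse ` (W \<inter> edge_points) \<subseteq> W \<inter> edge_points"
      by (rule traverse_push[OF W(4)])
    show "s \<in> squares X" "0 \<le> a" "a < b" "b \<le> 1"
      using y e(1) by (auto simp: a_def b_def)
    show "{s} \<times> ({a<..<b} - special) \<subseteq> W \<inter> edge_points"
    proof
      fix p assume p: "p \<in> {s} \<times> ({a<..<b} - special)"
      then have "fst p = s" "a < snd p" "snd p < b" "snd p \<notin> special"
        by auto
      then have "(s, snd p) \<in> W" "(s, snd p) \<in> edge_points"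
        using e(2)[rule_format, of "snd p"] y by (auto simp: a_def b_def edge_points_def)
      then show "p \<in> W \<inter> edge_points"
        using \<open>fst p = s\<close> by (metis IntI prod.collapse)
    qed
    fix s'
    have "special \<in> sets borel"
      by (rule sets.countable[OF _ countable_special]) simp
    moreover have "{y. (s', y) \<in> W} \<in> sets borel"
      using W(1) by (simp add: open_sections_def)
    moreover have "{y. (s', y) \<in> W \<inter> edge_points} =
        {y. (s', y) \<in> W} \<inter> (if s' \<in> squares X then {0<..<1} - special else {})"
      by (auto simp: edge_points_def)
    ultimately show "{y. (s', y) \<in> W \<inter> edge_points} \<in> sets borel"
      by auto
  qed auto
qed

section \<open>The orbit consists of finitely many intervals\<close>

definition long :: "real \<Rightarrow> ('s \<times> real) set" where
  "long \<epsilon> = {(s, y). \<exists>a b. a < y \<and> y < b \<and> \<epsilon> \<le> b - a \<and> {s} \<times> {a<..<b} \<subseteq> orbit}"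

lemma long_orbit: "long \<epsilon> \<subseteq> orbit"
  by (auto simp: long_def)

lemma longI: "a < y \<Longrightarrow> y < b \<Longrightarrow> \<epsilon> \<le> b - a \<Longrightarrow> {s} \<times> {a<..<b} \<subseteq> orbit \<Longrightarrow> (s, y) \<in> long \<epsilon>"
  unfolding long_def by blast

lemma long_open: "open_sections (long \<epsilon>)"
proof (rule open_sectionsI)
  fix s y assume "(s, y) \<in> long \<epsilon>"
  then obtain a b where ab: "a < y" "y < b" "\<epsilon> \<le> b - a" "{s} \<times> {a<..<b} \<subseteq> orbit"
    by (auto simp: long_def)
  then have "(s, y') \<in> long \<epsilon>" if "\<bar>y' - y\<bar> < min (y - a) (b - y)" for y'
    using that by (intro longI[of a y' b]) (auto simp: abs_less_iff)
  then show "\<exists>e>0. \<forall>y'. \<bar>y' - y\<bar> < e \<longrightarrow> (s, y') \<in> long \<epsilon>"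
    using ab by (intro exI[of _ "min (y - a) (b - y)"]) auto
qed

definition breaks :: "real set" where
  "breaks = {d. 0 < d \<and> d < 1 \<and> d + \<alpha> \<in> jumps}"

lemma finite_breaks: "finite breaks"
proof -
  have "(\<lambda>d. d + \<alpha>) ` breaks \<subseteq> jumps \<inter> {\<alpha>..1 + \<alpha>}"
    by (auto simp: breaks_def)
  then have "finite ((\<lambda>d. d + \<alpha>) ` breaks)"
    using finite_jumps by (rule finite_subset)
  then show ?thesis
    by (rule finite_imageD) simp
qed

text \<open>Each of the finitely many pairs imposes only an upper bound on \<open>r\<close>: the
  orbit is open at \<open>d\<close>, and the other breaks have positive distance from
  \<open>d\<close>. The filter collects these bounds.\<close>

lemma eventually_break_neighbourhood:
  "\<forall>\<^sub>F r in at_right 0. \<forall>(s, d)\<in>squares X \<times> breaks. (s, d) \<in> orbit \<longrightarrow>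
     {s} \<times> {d - r<..<d + r} \<subseteq> orbit \<and> {d - r<..<d + r} \<inter> breaks \<subseteq> {d}"
proof (intro eventually_ball_finite finite_cartesian_product finite_squares finite_breaks ballI)
  fix p assume "p \<in> squares X \<times> breaks"
  obtain s d where p: "p = (s, d)"
    by fastforce
  show "\<forall>\<^sub>F r in at_right 0. case p of (s, d) \<Rightarrow> (s, d) \<in> orbit \<longrightarrow>
     {s} \<times> {d - r<..<d + r} \<subseteq> orbit \<and> {d - r<..<d + r} \<inter> breaks \<subseteq> {d}"
  proof (cases "(s, d) \<in> orbit")
    case True
    then obtain e where e: "0 < e" "\<forall>y. \<bar>y - d\<bar> < e \<longrightarrow> (s, y) \<in> orbit"
      by (rule open_sectionsE[OF orbit_open])
    obtain e' where e': "0 < e'" "\<forall>x\<in>breaks. x \<noteq> d \<longrightarrow> e' \<le> dist d x"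
      using finite_set_avoid[OF finite_breaks] by blast
    have "{s} \<times> {d - r<..<d + r} \<subseteq> orbit \<and> {d - r<..<d + r} \<inter> breaks \<subseteq> {d}"
      if "0 < r" "r < min e e'" for r
    proof (intro conjI subsetI)
      fix q assume "q \<in> {s} \<times> {d - r<..<d + r}"
      then show "q \<in> orbit"
        using e(2)[rule_format, of "snd q"] that by (cases q) (auto simp: abs_less_iff)
    next
      fix x assume x: "x \<in> {d - r<..<d + r} \<inter> breaks"
      then have "\<not> e' \<le> dist d x"
        using that by (auto simp: dist_real_def abs_le_iff not_le abs_less_iff)
      then show "x \<in> {d}"
        using e'(2) x by blast
    qed
    then show ?thesis
      unfolding eventually_at_right_field p using e(1) e'(1)
      by (intro exI[of _ "min e e'"]) auto
  qed (simp add: p)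
qed

text \<open>
  A translation maps an interval of the orbit into one of at least the same length; an interval that
  is cut by a discontinuity leaves a piece of length at least \<open>\<epsilon>\<close> on each side, if \<open>\<epsilon>\<close> is smaller than
  the distance of every discontinuity inside the orbit to the complement and to the other
  discontinuities.
\<close>

lemma push_long:
  assumes \<epsilon>: "0 < \<epsilon>" "\<forall>(s, d)\<in>squares X \<times> breaks. (s, d) \<in> orbit \<longrightarrow>
     {s} \<times> {d - \<epsilon><..<d + \<epsilon>} \<subseteq> orbit \<and> {d - \<epsilon><..<d + \<epsilon>} \<inter> breaks \<subseteq> {d}"
  shows "push (long \<epsilon>) \<subseteq> long \<epsilon>"
proof
  fix p assume "p \<in> push (long \<epsilon>)"
  then obtain s y where p: "p = traverse (s, y)" "(s, y) \<in> long \<epsilon>" "y + \<alpha> \<notin> jumps"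
    by (auto simp: push_def)
  then obtain a b where ab: "a < y" "y < b" "\<epsilon> \<le> b - a" "{s} \<times> {a<..<b} \<subseteq> orbit"
    by (auto simp: long_def)
  have y: "y \<notin> breaks"
    using p by (simp add: breaks_def)
  have sub: "(s, w) \<in> orbit" "s \<in> squares X" "0 < w" "w < 1" if "w \<in> {a<..<b}" for w
  proof -
    show "(s, w) \<in> orbit"
      using ab(4) that by auto
    then have "(s, w) \<in> edges"
      using orbit_edges by blast
    then show "s \<in> squares X" "0 < w" "w < 1"
      by auto
  qed
  \<comment> \<open>An interval of the orbit around \<open>y\<close>, still of length at least
    \<open>\<epsilon>\<close>, on which \<open>traverse\<close> is a translation.\<close>
  obtain a' b' where ab': "a' < y" "y < b'" "\<epsilon> \<le> b' - a'" "{s} \<times> {a'<..<b'} \<subseteq> orbit"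
    "{a'<..<b'} \<inter> breaks = {}"
  proof (cases "{a<..<b} \<inter> breaks = {}")
    case False
    define D where "D = {a<..<b} \<inter> breaks"
    \<comment> \<open>The break closest to \<open>y\<close>. If it is nearer than
      \<open>\<epsilon>\<close>, the interval of length \<open>\<epsilon>\<close> beside it on the
      side of \<open>y\<close> is suitable, even where it leaves \<open>(a, b)\<close>.\<close>
    define d where "d = arg_min_on (\<lambda>d. \<bar>d - y\<bar>) D"
    have D: "finite D" "D \<noteq> {}"
      using finite_breaks False by (auto simp: D_def)
    have d: "d \<in> D" "\<And>x. x \<in> D \<Longrightarrow> \<bar>d - y\<bar> \<le> \<bar>x - y\<bar>"
      using arg_min_if_finite[OF D, of "\<lambda>d. \<bar>d - y\<bar>"] unfolding d_def by (auto simp: not_less)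
    have d_in: "d \<in> {a<..<b}" "d \<in> breaks"
      using d(1) by (auto simp: D_def)
    then have near: "{s} \<times> {d - \<epsilon><..<d + \<epsilon>} \<subseteq> orbit" "{d - \<epsilon><..<d + \<epsilon>} \<inter> breaks \<subseteq> {d}"
      using \<epsilon>(2) sub[of d] by auto
    have "d \<noteq> y"
      using d_in y by blast
    then consider "d < y" "y < d + \<epsilon>" | "d + \<epsilon> \<le> y" | "y < d" "d - \<epsilon> < y" | "y \<le> d - \<epsilon>"
      by linarith
    then show ?thesis
    proof cases
      case 1
      then show ?thesis
        using near by (intro that[of d "d + \<epsilon>"]) force+
    next
      case 2
      \<comment> \<open>Here \<open>y\<close> is at least \<open>\<epsilon>\<close> away from
        \<open>d\<close>. Up to the mirror image of \<open>d\<close> in \<open>y\<close> there is no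
        further break, as \<open>d\<close> is the closest; cutting at \<open>b\<close> still leaves
        a length of at least \<open>y - d\<close>.\<close>
      have "x \<notin> breaks" if "x \<in> {d<..<min b (y + (y - d))}" for x
      proof
        assume "x \<in> breaks"
        then have "x \<in> D"
          using that d_in by (auto simp: D_def)
        then show False
          using d(2)[of x] that 2 \<epsilon>(1) by (auto simp: abs_if split: if_splits)
      qed
      moreover have "{s} \<times> {d<..<min b (y + (y - d))} \<subseteq> orbit"
        using ab(4) d_in by auto
      ultimately show ?thesis
        using ab 2 \<epsilon>(1) by (intro that[of d "min b (y + (y - d))"]) auto
    next
      case 3
      then show ?thesis
        using near by (intro that[of "d - \<epsilon>" d]) force+
    next
      case 4
      have "x \<notin> breaks" if "x \<in> {max a (y - (d - y))<..<d}" for x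
      proof
        assume "x \<in> breaks"
        then have "x \<in> D"
          using that d_in by (auto simp: D_def)
        then show False
          using d(2)[of x] that 4 \<epsilon>(1) by (auto simp: abs_if split: if_splits)
      qed
      moreover have "{s} \<times> {max a (y - (d - y))<..<d} \<subseteq> orbit"
        using ab(4) d_in by auto
      ultimately show ?thesis
        using ab 4 \<epsilon>(1) by (intro that[of "max a (y - (d - y))" d]) auto
    qed
  qed (use ab that in blast)
  have sub': "0 < w" "w < 1" if "w \<in> {a'<..<b'}" for w
  proof -
    have "(s, w) \<in> edges"
      using ab'(4) that orbit_edges by blast
    then show "0 < w" "w < 1"
      by auto
  qed
  have no_jump: "w + \<alpha> \<notin> jumps" if "w \<in> {a'<..<b'}" for w
    using sub' that ab'(5) by (auto simp: breaks_def disjoint_iff)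
  have "{max 0 (a' + \<alpha>)<..<b' + \<alpha>} \<inter> jumps = {}"
    using no_jump[of "w - \<alpha>" for w] by (auto simp: disjoint_iff)
  have image: "(fst p, snd p + (w - y)) \<in> orbit" if w: "w \<in> {a'<..<b'}" for w
  proof -
    have "{max 0 (a' + \<alpha>)<..<b' + \<alpha>} \<inter> jumps = {}" by fact
    then have "hit s (w + \<alpha>) = (fst (hit s (y + \<alpha>)), snd (hit s (y + \<alpha>)) + (w + \<alpha> - (y + \<alpha>)))"
      using w ab' sub'[OF w] sub'[of y] slope_pos by (intro hit_translation) auto
    then have "traverse (s, w) = (fst p, snd p + (w - y))"
      using p(1) by (simp add: traverse_def)
    moreover have "(s, w) \<in> orbit"
      using ab'(4) w by blast
    then have "traverse (s, w) \<in> push orbit"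
      using no_jump[OF w] unfolding push_def by blast
    ultimately show ?thesis
      using push_orbit by auto
  qed
  have "(fst p, snd p) \<in> long \<epsilon>"
  proof (rule longI[of "snd p + (a' - y)" _ "snd p + (b' - y)"])
    show "{fst p} \<times> {snd p + (a' - y)<..<snd p + (b' - y)} \<subseteq> orbit"
    proof
      fix q assume "q \<in> {fst p} \<times> {snd p + (a' - y)<..<snd p + (b' - y)}"
      then have "q = (fst p, snd p + ((snd q - snd p + y) - y))" "snd q - snd p + y \<in> {a'<..<b'}"
        by (auto simp: prod_eq_iff)
      then show "q \<in> orbit"
        using image by metis
    qed
  qed (use ab' in auto)
  then show "p \<in> long \<epsilon>"
    by simp
qed

text \<open>An \<open>\<epsilon>\<close> below the size of one interval of the orbit makes
  \<open>long \<epsilon>\<close> nonempty, so it sweeps out \<open>C\<close> almost everywhere.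
  Equality with the orbit is nevertheless exact: every interval of the orbit meets a long one and
  merges with it into a long one.\<close>

lemma orbit_long: obtains \<epsilon> where "0 < \<epsilon>" "orbit = long \<epsilon>"
proof -
  obtain s0 y0 where s0: "(s0, y0) \<in> orbit"
    using I_nonempty I_orbit by fastforce
  then obtain e where e: "0 < e" "\<forall>y'. \<bar>y' - y0\<bar> < e \<longrightarrow> (s0, y') \<in> orbit"
    by (rule open_sectionsE[OF orbit_open])
  have "\<forall>\<^sub>F r in at_right 0. r < e"
    using e(1) by (auto simp: eventually_at_right_field)
  then have "\<forall>\<^sub>F r in at_right 0. r < e \<and> 0 < r \<and> (\<forall>(s, d)\<in>squares X \<times> breaks. (s, d) \<in> orbit \<longrightarrow>
     {s} \<times> {d - r<..<d + r} \<subseteq> orbit \<and> {d - r<..<d + r} \<inter> breaks \<subseteq> {d})"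
    using eventually_break_neighbourhood eventually_at_right_less by (intro eventually_conj)
  then obtain \<epsilon> where \<epsilon>: "\<epsilon> < e" "0 < \<epsilon>" "\<forall>(s, d)\<in>squares X \<times> breaks. (s, d) \<in> orbit \<longrightarrow>
     {s} \<times> {d - \<epsilon><..<d + \<epsilon>} \<subseteq> orbit \<and> {d - \<epsilon><..<d + \<epsilon>} \<inter> breaks \<subseteq> {d}"
    using eventually_happens'[OF trivial_limit_at_right_real] by blast
  have "(s0, y0) \<in> long \<epsilon>"
    using e \<epsilon>(1) by (intro longI[of "y0 - e" y0 "y0 + e"]) (auto simp: abs_less_iff)
  then have ae: "equal_ae X C (strip (long \<epsilon> \<inter> edge_points))"
    using component_open_strip[OF long_open long_orbit _ push_long[OF \<epsilon>(2,3)]] by blast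
  have "p \<in> long \<epsilon>" if p: "p \<in> orbit" for p
  proof -
    obtain s y where sy: "p = (s, y)"
      by fastforce
    with p have "(s, y) \<in> orbit"
      by simp
    then obtain e where e: "0 < e" "\<forall>y'. \<bar>y' - y\<bar> < e \<longrightarrow> (s, y') \<in> orbit"
      by (rule open_sectionsE[OF orbit_open])
    have "(s, y) \<in> edges"
      using sy p orbit_edges by blast
    then have y: "s \<in> squares X" "0 < y" "y < 1"
      by auto
    define a b where "a = max 0 (y - e)" and "b = min 1 (y + e)"
    have ab: "0 \<le> a" "a < y" "y < b" "b \<le> 1" "{s} \<times> {a<..<b} \<subseteq> orbit"
      using y e by (auto simp: a_def b_def abs_less_iff)
    have "{s} \<times> ({a<..<b} - special) = {s} \<times> {a<..<b} \<inter> edge_points"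
      using ab y by (auto simp: edge_points_def)
    then have "strip ({s} \<times> ({a<..<b} - special)) \<subseteq> C"
      using strip_orbit ab by simp
    moreover have "a < b"
      using ab by simp
    ultimately obtain w where w: "a < w" "w < b" "(s, w) \<in> long \<epsilon> \<inter> edge_points"
      using interval_meets[OF ae Int_lower2 y(1) ab(1) _ ab(4)] by blast
    then obtain a' b' where ab': "a' < w" "w < b'" "\<epsilon> \<le> b' - a'" "{s} \<times> {a'<..<b'} \<subseteq> orbit"
      by (auto simp: long_def)
    have "{min a a'<..<max b b'} \<subseteq> {a<..<b} \<union> {a'<..<b'}"
      using w ab' by auto
    then have "{s} \<times> {min a a'<..<max b b'} \<subseteq> orbit"
      using ab(5) ab'(4) by blast
    then show "p \<in> long \<epsilon>"
      unfolding sy using ab ab' by (intro longI[of "min a a'" y "max b b'"]) auto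
  qed
  then show ?thesis
    using that[of \<epsilon>] \<epsilon>(2) long_orbit by blast
qed

abbreviation section_at :: "'s \<Rightarrow> real set" where "section_at s \<equiv> {y. (s, y) \<in> orbit}"

lemma section_unit: "section_at s \<subseteq> {0<..<1}"
  using orbit_edges by blast

lemma frontier_section_unit: "frontier (section_at s) \<subseteq> {0..1}"
proof -
  have "closure (section_at s) \<subseteq> {0..1}"
    using section_unit[of s] by (intro closure_minimal) auto
  then show ?thesis
    by (auto simp: frontier_def)
qed

lemma finite_frontier_section: "finite (frontier (section_at s))"
proof -
  obtain \<epsilon> where "0 < \<epsilon>" "orbit = long \<epsilon>"
    by (rule orbit_long)
  moreover have "\<exists>a b. a < y \<and> y < b \<and> \<epsilon> \<le> b - a \<and> {a<..<b} \<subseteq> section_at s" if "(s, y) \<in> long \<epsilon>" for y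
    using that unfolding long_def by blast
  ultimately show ?thesis
    using section_unit by (intro finite_frontier_long_intervals[of _ \<epsilon>]) auto
qed

section \<open>Covering the orbit in finite time\<close>

definition ends :: "real set" where
  "ends = (\<Union>s\<in>squares X. frontier (section_at s))"

lemma finite_ends: "finite ends"
  using finite_frontier_section finite_squares by (simp add: ends_def)

lemma reached_away_from_ends:
  assumes "0 < \<eta>"
  obtains k where "\<And>s y. (s, y) \<in> orbit \<Longrightarrow> (s, y) \<notin> reached k \<Longrightarrow> \<exists>f\<in>ends. \<bar>y - f\<bar> < \<eta>"
proof -
  have "\<exists>k. \<forall>y. (s, y) \<in> orbit \<longrightarrow> (s, y) \<notin> reached k \<longrightarrow> (\<exists>f\<in>ends. \<bar>y - f\<bar> < \<eta>)"
    if s: "s \<in> squares X" for s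
  proof -
    let ?S = "section_at s"
    \<comment> \<open>Away from its frontier, the closure of the open section stays inside the
      section. So \<open>K\<close> is a compact part of it, covered by the increasing open sets
      \<open>reached k\<close>.\<close>
    define K where "K = closure ?S - (\<Union>f\<in>frontier ?S. ball f \<eta>)"
    have "bounded (closure ?S)"
      using section_unit[of s] bounded_subset[OF bounded_box[of 0 "1::real"]] by (intro bounded_closure) (simp add: box_real)
    then have "compact K"
      unfolding K_def by (intro compact_diff) (auto simp: compact_eq_bounded_closed)
    moreover have "open {y. (s, y) \<in> reached k}" for k
      using reached_open by (simp add: open_sections_def)
    moreover have "K \<subseteq> (\<Union>k\<in>UNIV. {y. (s, y) \<in> reached k})"
    proof
      fix y assume y: "y \<in> K"
      then have "y \<notin> frontier ?S"
        using assms by (auto simp: K_def)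
      moreover have "open ?S"
        using orbit_open by (simp add: open_sections_def)
      ultimately have "y \<in> ?S"
        using y by (auto simp: K_def frontier_def interior_open)
      then show "y \<in> (\<Union>k\<in>UNIV. {y. (s, y) \<in> reached k})"
        by (simp add: orbit_reached)
    qed
    ultimately obtain N where N: "finite N" "K \<subseteq> (\<Union>k\<in>N. {y. (s, y) \<in> reached k})"
      by (rule compactE_image)
    have "\<exists>f\<in>ends. \<bar>y - f\<bar> < \<eta>" if "(s, y) \<in> orbit" "(s, y) \<notin> reached (Max N)" for y
    proof -
      have "y \<notin> K"
        using N reached_mono[OF Max_ge[OF N(1)]] that(2) by blast
      moreover have "y \<in> closure ?S"
        using that(1) closure_subset[of ?S] by auto
      ultimately show ?thesis
        using s by (fastforce simp: K_def ends_def dist_real_def abs_minus_commute)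
    qed
    then show ?thesis
      by blast
  qed
  then obtain k where k: "\<And>s y. s \<in> squares X \<Longrightarrow> (s, y) \<in> orbit \<Longrightarrow> (s, y) \<notin> reached (k s) \<Longrightarrow>
      \<exists>f\<in>ends. \<bar>y - f\<bar> < \<eta>"
    by metis
  show ?thesis
  proof (rule that[of "Max (k ` squares X)"])
    fix s y assume *: "(s, y) \<in> orbit" "(s, y) \<notin> reached (Max (k ` squares X))"
    then have s: "s \<in> squares X"
      using orbit_edges by blast
    then have "k s \<le> Max (k ` squares X)"
      using finite_squares by simp
    then show "\<exists>f\<in>ends. \<bar>y - f\<bar> < \<eta>"
      using k[OF s *(1)] *(2) reached_mono by blast
  qed
qed

text \<open>A nonzero multiple of an irrational number has positive distance from the closed set of
  integers, and finitely many multiples share one bound. The factor 2 serves two heights that are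
  each closer than \<open>\<eta>\<close> to the same endpoint.\<close>

lemma multiples_away_from_integers:
  obtains \<eta> where "0 < \<eta>" "\<forall>n\<in>{1..m}. \<forall>k. 2 * \<eta> \<le> \<bar>real n * \<alpha> - of_int k\<bar>"
proof -
  have "\<exists>r>0. \<forall>k. r \<le> \<bar>real n * \<alpha> - of_int k\<bar>" if "1 \<le> n" for n
  proof -
    have "real n * \<alpha> \<notin> \<int>"
    proof
      assume "real n * \<alpha> \<in> \<int>"
      then have "real n * \<alpha> / real n \<in> \<rat>"
        using Ints_subset_Rats by (intro Rats_divide) auto
      then show False
        using irrational that by simp
    qed
    then have "setdist {real n * \<alpha>} \<int> > 0"
      using Ints_0 by (auto simp: setdist_gt_0_compact_closed)
    then show ?thesis
      using setdist_le_dist[of "real n * \<alpha>" "{real n * \<alpha>}" "of_int _" "\<int>"]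
      by (auto simp: dist_real_def)
  qed
  then have "\<forall>\<^sub>F r in at_right 0. \<forall>n\<in>{1..m}. \<forall>k. 2 * r \<le> \<bar>real n * \<alpha> - of_int k\<bar>"
  proof (intro eventually_ball_finite ballI)
    fix n assume *: "\<And>n. 1 \<le> n \<Longrightarrow> \<exists>r>0. \<forall>k. r \<le> \<bar>real n * \<alpha> - of_int k\<bar>" and "n \<in> {1..m}"
    then obtain r where r: "0 < r" "\<forall>k. r \<le> \<bar>real n * \<alpha> - of_int k\<bar>"
      by (meson atLeastAtMost_iff)
    have "\<forall>k. 2 * r' \<le> \<bar>real n * \<alpha> - of_int k\<bar>" if "r' < r / 2" for r'
    proof
      fix k
      show "2 * r' \<le> \<bar>real n * \<alpha> - of_int k\<bar>"
        using r(2)[rule_format, of k] that by linarith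
    qed
    then show "\<forall>\<^sub>F r in at_right 0. \<forall>k. 2 * r \<le> \<bar>real n * \<alpha> - of_int k\<bar>"
      using r(1) unfolding eventually_at_right_field by (intro exI[of _ "r / 2"]) auto
  qed auto
  then have "\<forall>\<^sub>F r in at_right 0. 0 < r \<and> (\<forall>n\<in>{1..m}. \<forall>k. 2 * r \<le> \<bar>real n * \<alpha> - of_int k\<bar>)"
    using eventually_at_right_less by (intro eventually_conj)
  then obtain r where "0 < r" "\<forall>n\<in>{1..m}. \<forall>k. 2 * r \<le> \<bar>real n * \<alpha> - of_int k\<bar>"
    using eventually_happens'[OF trivial_limit_at_right_real] by blast
  then show ?thesis
    by (rule that)
qed

text \<open>The return map is not injective, so a backward orbit has to be chosen step by step; the
  chain is indexed forwards, from \<open>c 0\<close> in \<open>W\<close> to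
  \<open>p\<close>.\<close>

lemma push_pow_chain:
  assumes "p \<in> (push ^^ n) W"
  shows "\<exists>c. c n = p \<and> (\<forall>i\<le>n. c i \<in> (push ^^ i) W) \<and> (\<forall>i<n. c (Suc i) \<in> push {c i})"
  using assms
proof (induction n arbitrary: p)
  case 0
  then show ?case
    by (intro exI[of _ "\<lambda>_. p"]) auto
next
  case (Suc n)
  then have "p \<in> push ((push ^^ n) W)"
    by simp
  then obtain q where q: "q \<in> (push ^^ n) W" "p \<in> push {q}"
    unfolding push_def by blast
  obtain c where c: "c n = q" "\<forall>i\<le>n. c i \<in> (push ^^ i) W" "\<forall>i<n. c (Suc i) \<in> push {c i}"
    using Suc.IH[OF q(1)] by blast
  then show ?case
    using q Suc.prems
    by (intro exI[of _ "c(Suc n := p)"]) (auto simp: le_Suc_eq less_Suc_eq)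
qed

text \<open>
  Backward orbits of length \<open>card ends\<close> cannot avoid \<open>reached k\<close>: otherwise two of their heights would
  be close to the same point of \<open>ends\<close>, but they differ by a nonzero multiple of the irrational \<open>\<alpha>\<close>
  modulo one.
\<close>

lemma push_pow_orbit_reached: obtains k where "(push ^^ card ends) orbit \<subseteq> reached k"
proof -
  let ?m = "card ends"
  obtain \<eta> where \<eta>: "0 < \<eta>" "\<forall>n\<in>{1..?m}. \<forall>k. 2 * \<eta> \<le> \<bar>real n * \<alpha> - of_int k\<bar>"
    by (rule multiples_away_from_integers[of ?m])
  obtain k where k: "\<And>s y. (s, y) \<in> orbit \<Longrightarrow> (s, y) \<notin> reached k \<Longrightarrow> \<exists>f\<in>ends. \<bar>y - f\<bar> < \<eta>"
    using reached_away_from_ends[OF \<eta>(1)] by blast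
  have "p \<in> reached (k + ?m)" if p: "p \<in> (push ^^ ?m) orbit" for p
  proof (rule ccontr)
    assume not_reached: "p \<notin> reached (k + ?m)"
    obtain c where c: "c ?m = p" "\<And>i. i \<le> ?m \<Longrightarrow> c i \<in> (push ^^ i) orbit"
      "\<And>i. i < ?m \<Longrightarrow> c (Suc i) \<in> push {c i}"
      using push_pow_chain[OF p] by blast
    have "(push ^^ i) orbit \<subseteq> orbit" for i
      by (induction i) (use push_mono push_orbit in \<open>auto, blast\<close>)
    then have c_orbit: "c i \<in> orbit" if "i \<le> ?m" for i
      using c(2)[OF that] by blast
    \<comment> \<open>From \<open>reached k\<close>, the remaining \<open>card ends - i\<close>
      steps would carry the chain to \<open>p\<close> within
      \<open>reached (k + card ends)\<close>.\<close>
    have "c i \<notin> reached k" if "i \<le> ?m" for i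
    proof
      assume *: "c i \<in> reached k"
      have "c (i + j) \<in> reached (k + j)" if "i + j \<le> ?m" for j
        using that
      proof (induction j)
        case (Suc j)
        then have "push {c (i + j)} \<subseteq> push (reached (k + j))"
          by (intro push_mono) auto
        then show ?case
          using c(3)[of "i + j"] Suc push_reached by fastforce
      qed (simp add: *)
      from this[of "?m - i"] have "p \<in> reached (k + (?m - i))"
        using that c(1) by simp
      then show False
        using not_reached reached_mono[of "k + (?m - i)" "k + ?m"] by auto
    qed
    then have "\<forall>i\<in>{..?m}. \<exists>f\<in>ends. \<bar>snd (c i) - f\<bar> < \<eta>"
      using k c_orbit by (metis atMost_iff prod.collapse)
    then obtain f where f: "\<And>i. i \<le> ?m \<Longrightarrow> f i \<in> ends" "\<And>i. i \<le> ?m \<Longrightarrow> \<bar>snd (c i) - f i\<bar> < \<eta>"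
      by (metis atMost_iff)
    \<comment> \<open>The chain has \<open>card ends + 1\<close> members, so two of them are
      assigned the same endpoint.\<close>
    have "card (f ` {..?m}) \<le> ?m"
      using f(1) finite_ends by (intro card_mono) auto
    then have "\<not> inj_on f {..?m}"
      using pigeonhole[of f "{..?m}"] by simp
    then obtain i j where ij: "i < j" "j \<le> ?m" "f i = f j"
      using linorder_inj_onI[of "{..?m}" f] by (metis atMost_iff linear)
    have "\<exists>z::int. snd (c (i + n)) = snd (c i) + real n * \<alpha> - of_int z" if "i + n \<le> ?m" for n
      using that
    proof (induction n)
      case (Suc n)
      then obtain z where z: "snd (c (i + n)) = snd (c i) + real n * \<alpha> - of_int z"
        by auto
      have "c (i + Suc n) \<in> push {c (i + n)}"
        using c(3)[of "i + n"] Suc.prems by simp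
      then have "snd (c (i + Suc n)) = frac (snd (c (i + n)) + \<alpha>)"
        by (cases "c (i + n)") (auto simp: push_def traverse_def snd_hit)
      also have "\<dots> = snd (c i) + real (Suc n) * \<alpha> - of_int (z + \<lfloor>snd (c (i + n)) + \<alpha>\<rfloor>)"
        unfolding frac_def z by (simp add: algebra_simps)
      finally show ?case
        by blast
    qed (auto intro: exI[of _ 0])
    from this[of "j - i"] ij obtain z :: int where
      "snd (c j) = snd (c i) + real (j - i) * \<alpha> - of_int z"
      by auto
    moreover have "2 * \<eta> \<le> \<bar>real (j - i) * \<alpha> - of_int z\<bar>"
      using ij by (intro \<eta>(2)[rule_format]) auto
    ultimately have "2 * \<eta> \<le> \<bar>snd (c j) - snd (c i)\<bar>"
      by simp
    then show False
      using f(2)[of i] f(2)[of j] ij by linarith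
  qed
  then show ?thesis
    using that by blast
qed

lemma equal_ae_between:
  assumes "equal_ae X C S" "S \<subseteq> B" "B \<subseteq> C"
  shows "equal_ae X C B"
  unfolding equal_ae_def surface_null_def
proof
  fix s assume "s \<in> squares X"
  then have "in_square X (C - S \<union> (S - C)) s \<in> null_sets lebesgue"
    using assms(1) by (simp add: equal_ae_def surface_null_def)
  moreover have "in_square X (C - B \<union> (B - C)) s \<subseteq> in_square X (C - S \<union> (S - C)) s"
    using assms(2,3) by (auto simp: in_square_def)
  ultimately show "in_square X (C - B \<union> (B - C)) s \<in> null_sets lebesgue"
    using negligible_subset negligible_iff_null_sets by blast
qed

lemma component_finite_time: "\<exists>T\<ge>0. equal_ae X C (\<Union>t\<in>{0..T}. advance X \<alpha> t G)"
proof -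
  let ?W = "(push ^^ card ends) orbit"
  obtain k where k: "?W \<subseteq> reached k"
    by (rule push_pow_orbit_reached)
  \<comment> \<open>An iterated image of an invariant set is invariant, because \<open>push\<close>
    commutes with its own powers. Hence minimality applies to \<open>?W\<close>.\<close>
  have "push ?W = (push ^^ card ends) (push orbit)"
    by (simp add: funpow_swap1)
  also have "\<dots> \<subseteq> ?W"
    using push_pow_mono push_orbit by blast
  finally have "equal_ae X C (strip (?W \<inter> edge_points))"
    using orbit_open orbit_edges I_nonempty I_orbit k reached_orbit
    by (intro component_open_strip open_push_pow push_pow_nonempty) blast+
  moreover have "strip (?W \<inter> edge_points) \<subseteq> (\<Union>t\<in>{0..t0 + (of_nat k + 1) * speed}. advance X \<alpha> t G)"
    using strip_reached[of k] strip_mono[of "?W \<inter> edge_points" "reached k \<inter> edge_points"] k by blast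
  moreover have "(\<Union>t\<in>{0..t0 + (of_nat k + 1) * speed}. advance X \<alpha> t G) \<subseteq> C"
    using advance_G by (intro UN_least) simp
  ultimately have "equal_ae X C (\<Union>t\<in>{0..t0 + (of_nat k + 1) * speed}. advance X \<alpha> t G)"
    by (rule equal_ae_between)
  moreover have "0 \<le> t0 + (of_nat k + 1) * speed"
    using time speed_pos by simp
  ultimately show ?thesis
    by blast
qed

lemma component_strip_orbit: "equal_ae X C (strip (orbit \<inter> edge_points))"
  using component_open_strip[OF orbit_open _ _ push_orbit] I_nonempty I_orbit by blast

end

section \<open>Polygons\<close>

definition parallelogram :: "real \<Rightarrow> real \<Rightarrow> real \<Rightarrow> (real \<times> real) set" where
  "parallelogram \<alpha> p q = {(x, z). 0 \<le> x \<and> x \<le> 1 \<and> p \<le> z - \<alpha> * x \<and> z - \<alpha> * x \<le> q}"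

text \<open>The source is the complex plane because \<open>rectpath\<close> lives there. Vertical
  sides of a rectangle stay vertical, and horizontal sides obtain slope
  \<open>\<alpha>\<close>.\<close>

definition shear :: "real \<Rightarrow> complex \<Rightarrow> real \<times> real" where
  "shear \<alpha> w = (Re w, Im w + \<alpha> * Re w)"

lemma linear_shear: "linear (shear \<alpha>)"
  by (intro linearI) (auto simp: shear_def algebra_simps)

lemma bij_shear: "bij (shear \<alpha>)"
proof (rule o_bij)
  show "(\<lambda>(x, z). Complex x (z - \<alpha> * x)) \<circ> shear \<alpha> = id"
    "shear \<alpha> \<circ> (\<lambda>(x, z). Complex x (z - \<alpha> * x)) = id"
    by (auto simp: shear_def fun_eq_iff complex_eq_iff)
qed

lemma shear_cbox: "shear \<alpha> ` cbox (Complex 0 p) (Complex 1 q) = parallelogram \<alpha> p q"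
proof (intro equalityI subsetI)
  fix w assume "w \<in> parallelogram \<alpha> p q"
  then have "w = shear \<alpha> (Complex (fst w) (snd w - \<alpha> * fst w))"
    "Complex (fst w) (snd w - \<alpha> * fst w) \<in> cbox (Complex 0 p) (Complex 1 q)"
    by (auto simp: parallelogram_def shear_def in_cbox_complex_iff)
  then show "w \<in> shear \<alpha> ` cbox (Complex 0 p) (Complex 1 q)"
    by blast
qed (auto simp: parallelogram_def shear_def in_cbox_complex_iff)

lemma interior_parallelogram:
  "interior (parallelogram \<alpha> p q) = {(x, z). 0 < x \<and> x < 1 \<and> p < z - \<alpha> * x \<and> z - \<alpha> * x < q}"
proof -
  have "interior (parallelogram \<alpha> p q) = shear \<alpha> ` box (Complex 0 p) (Complex 1 q)"
    unfolding shear_cbox[symmetric]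
    by (subst interior_bijective_linear_image[OF linear_shear bij_shear]) (simp add: interior_cbox)
  also have "\<dots> = {(x, z). 0 < x \<and> x < 1 \<and> p < z - \<alpha> * x \<and> z - \<alpha> * x < q}" (is "_ = ?R")
  proof (intro equalityI subsetI)
    fix w assume "w \<in> ?R"
    then have "w = shear \<alpha> (Complex (fst w) (snd w - \<alpha> * fst w))"
      "Complex (fst w) (snd w - \<alpha> * fst w) \<in> box (Complex 0 p) (Complex 1 q)"
      by (auto simp: shear_def in_box_complex_iff)
    then show "w \<in> shear \<alpha> ` box (Complex 0 p) (Complex 1 q)"
      by blast
  qed (auto simp: shear_def in_box_complex_iff)
  finally show ?thesis .
qed

text \<open>The boundary curve is a sheared rectangle path, which stays simple under a linear
  bijection. Its image is the frontier, and the inside of the frontier of a bounded convex set is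
  the interior.\<close>

lemma planar_polygon_parallelogram:
  assumes "p < q"
  shows "planar_polygon \<alpha> (parallelogram \<alpha> p q)"
proof -
  let ?K = "parallelogram \<alpha> p q" and ?a = "Complex 0 p" and ?b = "Complex 1 q"
  let ?a2 = "Complex 1 p" and ?a4 = "Complex 0 q"
  let ?h = "shear \<alpha>"
  define g where "g = ?h \<circ> rectpath ?a ?b"
  define E where "E = {(?h ?a, ?h ?a2), (?h ?a2, ?h ?b), (?h ?b, ?h ?a4), (?h ?a4, ?h ?a)}"
  have "simple_path g"
    unfolding g_def using assms bij_is_inj[OF bij_shear]
    by (simp add: simple_path_linear_image_eq[OF linear_shear])
  moreover have "pathfinish g = pathstart g"
    by (simp add: g_def pathfinish_compose pathstart_compose)
  moreover have "finite E" "\<forall>(p, q)\<in>E. vertical_or_slope \<alpha> p q"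
    by (auto simp: E_def vertical_or_slope_def shear_def)
  moreover have "path_image g = (\<Union>(p, q)\<in>E. closed_segment p q)"
  proof -
    have "path_image (rectpath ?a ?b) =
        closed_segment ?a ?a2 \<union> closed_segment ?a2 ?b \<union> closed_segment ?b ?a4 \<union> closed_segment ?a4 ?a"
      by (auto simp: rectpath_def Let_def path_image_join)
    then show ?thesis
      by (simp add: g_def E_def path_image_compose image_Un closed_segment_linear_image[OF linear_shear] Un_assoc)
  qed
  moreover have "?K = path_image g \<union> inside (path_image g)"
  proof -
    have "compact ?K"
      unfolding shear_cbox[symmetric] shear_def
      by (intro compact_continuous_image continuous_intros compact_cbox)
    then have "closed ?K" "bounded ?K"
      by (simp_all add: compact_imp_closed compact_imp_bounded)
    have "convex ?K"
      unfolding shear_cbox[symmetric] by (intro convex_linear_image linear_shear convex_box)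
    have "path_image (rectpath ?a ?b) = cbox ?a ?b - box ?a ?b"
      using assms by (intro path_image_rectpath_cbox_minus_box) auto
    then have "path_image g = ?h ` (cbox ?a ?b - box ?a ?b)"
      by (simp add: g_def path_image_compose)
    also have "\<dots> = ?K - interior ?K"
      unfolding shear_cbox[symmetric] interior_bijective_linear_image[OF linear_shear bij_shear]
      by (simp add: image_set_diff[OF bij_is_inj[OF bij_shear]] interior_cbox)
    also have "\<dots> = frontier ?K"
      using \<open>closed ?K\<close> by (simp add: frontier_def)
    finally have "path_image g = frontier ?K" .
    moreover have "inside (frontier ?K) = interior ?K"
      using \<open>bounded ?K\<close> \<open>convex ?K\<close> by (rule inside_frontier_eq_interior)
    ultimately show ?thesis
      using \<open>closed ?K\<close> interior_subset by (auto simp: frontier_def)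
  qed
  ultimately show ?thesis
    unfolding planar_polygon_def by blast
qed

text \<open>Take the neighbours of \<open>y\<close> in \<open>P\<close>. No frontier point lies
  between them, so by connectedness the interval cannot leave \<open>S\<close>. This yields finitely
  many intervals without describing the components of \<open>S\<close>.\<close>

lemma interval_between_frontier_points:
  fixes S :: "real set"
  assumes "open S" "y \<in> S" and P: "finite P" "frontier S \<subseteq> P" and "a \<in> P" "a < y" "b \<in> P" "y < b"
  obtains p q where "p \<in> P" "q \<in> P" "p < y" "y < q" "{p<..<q} \<subseteq> S"
proof -
  define p where "p = Max {t \<in> P. t < y}"
  define q where "q = Min {t \<in> P. y < t}"
  have p: "p \<in> {t \<in> P. t < y}"
    unfolding p_def using assms by (intro Max_in) auto
  have q: "q \<in> {t \<in> P. y < t}"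
    unfolding q_def using assms by (intro Min_in) auto
  have "{p<..<q} \<subseteq> S"
  proof (rule ccontr)
    assume "\<not> {p<..<q} \<subseteq> S"
    moreover have "y \<in> {p<..<q} \<inter> S"
      using p q assms by auto
    ultimately have "{p<..<q} \<inter> frontier S \<noteq> {}"
      by (intro connected_Int_frontier[OF connected_Ioo]) blast+
    then obtain f where f: "f \<in> {p<..<q}" "f \<in> frontier S"
      by blast
    then have "f \<noteq> y" "f \<in> P"
      using assms by (auto simp: frontier_def interior_open)
    then have "f \<le> p \<or> q \<le> f"
      using P(1) unfolding p_def q_def by (cases "f < y") (auto intro!: Max_ge Min_le)
    then show False
      using f by auto
  qed
  then show ?thesis
    using that p q by auto
qed

lemma equal_ae_trans:
  assumes "equal_ae X A B" "equal_ae X B D"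
  shows "equal_ae X A D"
  unfolding equal_ae_def surface_null_def
proof
  fix s assume "s \<in> squares X"
  then have "negligible (in_square X (A - B \<union> (B - A)) s)" "negligible (in_square X (B - D \<union> (D - B)) s)"
    using assms by (auto simp: equal_ae_def surface_null_def negligible_iff_null_sets)
  then have "negligible (in_square X (A - B \<union> (B - A)) s \<union> in_square X (B - D \<union> (D - B)) s)"
    by (rule negligible_Un)
  then have "negligible (in_square X (A - D \<union> (D - A)) s)"
    by (rule negligible_subset) (auto simp: in_square_def)
  then show "in_square X (A - D \<union> (D - A)) s \<in> null_sets lebesgue"
    by (simp add: negligible_iff_null_sets)
qed

lemma continuous_map_pt:
  assumes "s \<in> squares X"
  shows "continuous_map (top_of_set unit_square) (surface_topology X) (pt X s)"
  unfolding continuous_map_def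
proof (intro conjI allI impI)
  show "pt X s \<in> topspace (top_of_set unit_square) \<rightarrow> topspace (surface_topology X)"
    using assms by (auto simp: topspace_surface_topology surface_def)
  fix U assume "openin (surface_topology X) U"
  then show "openin (top_of_set unit_square) {x \<in> topspace (top_of_set unit_square). pt X s x \<in> U}"
    using assms by (simp add: openin_surface_topology surface_open_def in_square_def)
qed

section \<open>Laying the parallelograms on the surface\<close>

context dissipative_flow
begin

text \<open>From \<open>0 < x < 1\<close> a chain of gluings can cross only horizontal edges, which
  keeps \<open>x\<close> and changes \<open>y\<close> by an integer. Nongeneric points are covered
  too, as injectivity of a polygon concerns every interior point.\<close>

lemma pt_eq_columnD:
  assumes "pt X s (x, y) = pt X s' (x', y')" and "0 < x" "x < 1"
  shows "x' = x \<and> frac y' = frac y"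
proof -
  have "((s, x, y), (s', x', y')) \<in> (gluing X \<union> (gluing X)\<inverse>)\<^sup>*"
    using assms(1) unfolding pt_def by blast
  then show ?thesis
  proof (induction "(s', x', y')" arbitrary: s' x' y' rule: rtrancl_induct)
    case (step q)
    obtain s1 x1 y1 where q: "q = (s1, x1, y1)"
      using prod_cases3 by blast
    have "x1 = x \<and> frac y1 = frac y"
      using step.hyps(3) q by blast
    then show ?case
      using step.hyps(2) q assms(2,3) by (auto simp: gluing_def)
  qed simp
qed

text \<open>Pasting along the horizontal edges: \<open>K\<close> meets finitely many closed slabs of
  height 1, on each of which the column is one chart, and \<open>column_eq_closed\<close> gives
  agreement where slabs meet.\<close>

lemma continuous_column:
  assumes s: "s \<in> squares X" and K: "K \<subseteq> {0..1} \<times> {0..of_nat n}"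
  shows "continuous_map (top_of_set K) (surface_topology X) (column s)"
proof (rule pasting_lemma_closed)
  let ?T = "\<lambda>k::nat. {w. of_nat k \<le> snd w \<and> snd w \<le> of_nat k + 1} :: (real \<times> real) set"
  let ?f = "\<lambda>k w. pt X ((upw X ^^ k) s) (fst w, snd w - of_nat k)"
  show "finite {..n}"
    by simp
  have "closed (?T k)" for k
    by (intro closed_Collect_conj closed_Collect_le continuous_intros)
  then show "closedin (top_of_set K) (K \<inter> ?T k)" for k
    by (simp add: closedin_closed_Int)
  show "continuous_map (subtopology (top_of_set K) (K \<inter> ?T k)) (surface_topology X) (?f k)" for k
  proof -
    have "continuous_map (top_of_set (K \<inter> ?T k)) (top_of_set unit_square) (\<lambda>w. (fst w, snd w - of_nat k))"
      using K by (auto simp: continuous_map_in_subtopology unit_square_def intro!: continuous_intros)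
    from continuous_map_compose[OF this continuous_map_pt[OF upw_square[OF s, of k]]] show ?thesis
      by (simp add: subtopology_subtopology o_def Int_absorb2)
  qed
  have eq: "column s w = ?f k w" if "w \<in> K" "w \<in> ?T k" for k w
    using column_eq_closed[of k "snd w" s "fst w"] that s K by (cases w) auto
  then show "?f i w = ?f j w" if "w \<in> topspace (top_of_set K) \<inter> (K \<inter> ?T i) \<inter> (K \<inter> ?T j)" for i j w
    using that by (metis (no_types, lifting) IntD1 IntD2)
  show "\<exists>j. j \<in> {..n} \<and> w \<in> K \<inter> ?T j \<and> column s w = ?f j w" if "w \<in> topspace (top_of_set K)" for w
  proof -
    have w: "w \<in> K" "0 \<le> snd w" "snd w \<le> of_nat n"
      using that K by auto
    then obtain k :: nat where k: "of_nat k \<le> snd w" "snd w < of_nat k + 1"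
      using floor_natE by blast
    then have "k \<le> n"
      using w by linarith
    then show ?thesis
      using k w eq[of w k] by (intro exI[of _ k]) auto
  qed
qed

lemma local_translation_column:
  assumes s: "s \<in> squares X" and U: "U \<subseteq> {0<..<1} \<times> {0<..}"
  shows "local_translation X U (column s)"
  unfolding local_translation_def
proof
  fix w assume "w \<in> U"
  then obtain x z where w: "w = (x, z)" "0 < x" "x < 1" "0 < z"
    using U by auto
  \<comment> \<open>Rounding up and subtracting 1, rather than rounding down: at an integer height
    \<open>z\<close> the common edge then lies in the middle of the patch and not on its lower
    boundary.\<close>
  define j where "j = nat (\<lceil>z\<rceil> - 1)"
  have "real j = of_int \<lceil>z\<rceil> - 1"
    using w(4) by (simp add: j_def)
  then have j: "of_nat j < z" "z \<le> of_nat j + 1"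
    by linarith+
  define e where "e = min (min x (1 - x)) (min (z - of_nat j) 1)"
  have "v - (0, of_nat j) \<in> patch_domain X ((upw X ^^ j) s) \<and>
      column s v = patch X ((upw X ^^ j) s) (v - (0, of_nat j))" if "v \<in> ball w e" for v
  proof -
    obtain x' z' where v: "v = (x', z')"
      by fastforce
    have "\<bar>x - x'\<bar> < e" "\<bar>z - z'\<bar> < e"
      using that w v dist_fst_le[of w v] dist_snd_le[of w v] by (auto simp: dist_real_def)
    then have b: "0 < x'" "x' < 1" "of_nat j < z'" "z' < of_nat j + 2"
      using j by (auto simp: e_def abs_less_iff)
    then have "v - (0, of_nat j) \<in> patch_domain X ((upw X ^^ j) s)"
      by (simp add: v patch_domain_def)
    moreover have "column s v = patch X ((upw X ^^ j) s) (v - (0, of_nat j))"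
    proof (cases "z' < of_nat j + 1")
      case True
      then show ?thesis
        using column_eq[of j z' s x'] b v by (simp add: patch_def)
    next
      case False
      then show ?thesis
        using column_eq[of "Suc j" z' s x'] b v by (simp add: patch_def algebra_simps)
    qed
    ultimately show ?thesis
      by blast
  qed
  moreover have "0 < e"
    using w j by (simp add: e_def)
  ultimately show "\<exists>s'\<in>squares X. \<exists>w'. \<exists>e>0. \<forall>v\<in>ball w e. v - w' \<in> patch_domain X s' \<and>
      column s v = patch X s' (v - w')"
    using upw_square[OF s, of j] by blast
qed

lemma surface_polygon_column:
  assumes s: "s \<in> squares X" and pq: "0 \<le> p" "p < q" "q \<le> 1"
  shows "surface_polygon X \<alpha> (column s ` parallelogram \<alpha> p q)"
proof -
  let ?K = "parallelogram \<alpha> p q"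
  have slope: "0 \<le> \<alpha> * x" "\<alpha> * x \<le> \<alpha>" if "0 \<le> x" "x \<le> 1" for x
    using slope_pos that by (auto simp: mult_left_le)
  obtain n :: nat where "q + \<alpha> \<le> of_nat n"
    using real_arch_simple by blast
  then have "(x, z) \<in> {0..1} \<times> {0..of_nat n}" if "(x, z) \<in> ?K" for x z
    using pq slope[of x] that by (auto simp: parallelogram_def)
  then have "?K \<subseteq> {0..1} \<times> {0..of_nat n}"
    by auto
  then have "continuous_map (top_of_set ?K) (surface_topology X) (column s)"
    by (rule continuous_column[OF s])
  moreover have int: "0 < x" "x < 1" "p < z - \<alpha> * x" "z - \<alpha> * x < q" "0 < z"
    if "(x, z) \<in> interior ?K" for x z
    using that pq slope[of x] by (auto simp: interior_parallelogram)
  then have "local_translation X (interior ?K) (column s)"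
    by (intro local_translation_column[OF s]) auto
  moreover have "inj_on (column s) (interior ?K)"
  proof (rule inj_onI)
    fix v w assume vw: "v \<in> interior ?K" "w \<in> interior ?K" "column s v = column s w"
    obtain x z x' z' where eq: "v = (x, z)" "w = (x', z')"
      by fastforce
    have v: "0 < x" "x < 1" "p < z - \<alpha> * x" "z - \<alpha> * x < q" "0 < z"
      and w: "0 < x'" "x' < 1" "p < z' - \<alpha> * x'" "z' - \<alpha> * x' < q" "0 < z'"
      using vw eq int by blast+
    obtain k :: nat where k: "of_nat k \<le> z" "z < of_nat k + 1"
      using floor_natE[of z] v by auto
    obtain k' :: nat where k': "of_nat k' \<le> z'" "z' < of_nat k' + 1"
      using floor_natE[of z'] w by auto
    have pts: "pt X ((upw X ^^ k) s) (x, z - of_nat k) = pt X ((upw X ^^ k') s) (x', z' - of_nat k')"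
      using vw(3) eq column_eq[OF k] column_eq[OF k'] by simp
    have "frac (z - of_nat k) = z - of_nat k" "frac (z' - of_nat k') = z' - of_nat k'"
      using k k' by (simp_all add: frac_eq)
    then have "x = x' \<and> z - of_nat k = z' - of_nat k'"
      using pt_eq_columnD[OF pts v(1,2)] by simp
    \<comment> \<open>At equal abscissas, \<open>z - z'\<close> is less than
      \<open>q - p \<le> 1\<close> in absolute value; it also equals \<open>k - k'\<close>.\<close>
    moreover from this have "\<bar>real k - real k'\<bar> < 1"
      using v w pq by (auto simp: abs_less_iff)
    then have "k = k'"
      by linarith
    ultimately show "v = w"
      by (simp add: eq)
  qed
  ultimately show ?thesis
    unfolding surface_polygon_def using planar_polygon_parallelogram[OF pq(2)] by blast
qed

end

context open_component
begin

lemma orbit_polygons: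
  "\<exists>F. finite F \<and> (\<forall>Q\<in>F. surface_polygon X \<alpha> Q) \<and> equal_ae X C (\<Union>F)"
proof -
  \<comment> \<open>0 and 1 are added so that every height in \<open>(0,1)\<close> has a member of
    \<open>P\<close> on either side.\<close>
  define P where "P = insert 0 (insert 1 ends)"
  define A where "A = {(s, p, q). s \<in> squares X \<and> p \<in> P \<and> q \<in> P \<and> 0 \<le> p \<and> p < q \<and> q \<le> 1 \<and>
    {p<..<q} \<subseteq> section_at s}"
  define F where "F = (\<lambda>(s, p, q). column s ` parallelogram \<alpha> p q) ` A"
  have "finite P"
    using finite_ends by (simp add: P_def)
  moreover have "A \<subseteq> squares X \<times> P \<times> P"
    by (auto simp: A_def)
  ultimately have "finite A"
    using finite_squares finite_subset by blast
  then have "finite F"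
    by (simp add: F_def)
  moreover have "\<forall>Q\<in>F. surface_polygon X \<alpha> Q"
    by (auto simp: F_def A_def intro: surface_polygon_column)
  moreover have "equal_ae X (strip (orbit \<inter> edge_points)) (\<Union>F)"
  proof (rule equal_aeI)
    \<comment> \<open>Besides \<open>special\<close>, the slanted sides of the parallelograms are
      discarded: a side of intercept \<open>p\<close> appears with intercept \<open>p - k\<close> in
      the square reached after \<open>k\<close> horizontal edges.\<close>
    let ?Q = "special \<union> (\<lambda>(p, k :: nat). p - of_nat k) ` (P \<times> UNIV)"
    show "countable ?Q" for s :: 's
      using countable_special \<open>finite P\<close> by (intro countable_Un countable_image countable_SIGMA) (auto intro: countable_finite)
    fix s x y assume s: "s \<in> squares X" and xy: "0 < x" "x < 1" "0 < y" "y < 1" and Q: "y - \<alpha> * x \<notin> ?Q"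
    have not_P: "y - \<alpha> * x + of_nat k \<notin> P" for k :: nat
    proof
      assume "y - \<alpha> * x + of_nat k \<in> P"
      then have "y - \<alpha> * x + of_nat k - of_nat k \<in> ?Q"
        by (intro UnI2 image_eqI[of _ _ "(y - \<alpha> * x + of_nat k, k)"]) auto
      then show False
        using Q by simp
    qed
    show "pt X s (x, y) \<in> strip (orbit \<inter> edge_points) \<longleftrightarrow> pt X s (x, y) \<in> \<Union>F"
    proof
      assume "pt X s (x, y) \<in> strip (orbit \<inter> edge_points)"
      then obtain s0 y0 k where *: "(s0, y0) \<in> orbit" "(s0, y0) \<in> edge_points" "y0 + \<alpha> * x = y + of_nat k"
        "(upw X ^^ k) s0 = s"
        unfolding strip_interior_iff[OF Int_lower2 xy] by blast
      note y0 = edge_pointsD[OF *(2)]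
      have "open (section_at s0)"
        using orbit_open by (simp add: open_sections_def)
      moreover have "frontier (section_at s0) \<subseteq> P"
        using y0(1) by (auto simp: P_def ends_def)
      then have "frontier (section_at s0) \<subseteq> P \<inter> {0..1}"
        using frontier_section_unit by blast
      moreover have "y0 \<in> section_at s0" "0 \<in> P \<inter> {0..1}" "1 \<in> P \<inter> {0..1}" "finite (P \<inter> {0..1})"
        using *(1) \<open>finite P\<close> by (auto simp: P_def)
      ultimately obtain p q where pq: "p \<in> P \<inter> {0..1}" "q \<in> P \<inter> {0..1}" "p < y0" "y0 < q"
        "{p<..<q} \<subseteq> section_at s0"
        using interval_between_frontier_points[of "section_at s0" y0 "P \<inter> {0..1}" 0 1] y0(2,3) by metis
      then have "(s0, p, q) \<in> A"
        using y0(1) by (auto simp: A_def)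
      moreover have "(x, y + of_nat k) \<in> parallelogram \<alpha> p q"
        using * pq xy by (simp add: parallelogram_def)
      moreover have "column s0 (x, y + of_nat k) = pt X s (x, y)"
        using column_eq[of k "y + of_nat k" s0 x] * xy by simp
      ultimately show "pt X s (x, y) \<in> \<Union>F"
        unfolding F_def by force
    next
      assume "pt X s (x, y) \<in> \<Union>F"
      then obtain s0 p q x' z where *: "(s0, p, q) \<in> A" "(x', z) \<in> parallelogram \<alpha> p q"
        "pt X s (x, y) = column s0 (x', z)"
        by (auto simp: F_def)
      have A: "s0 \<in> squares X" "p \<in> P" "q \<in> P" "0 \<le> p" "q \<le> 1" "{p<..<q} \<subseteq> section_at s0"
        using *(1) by (auto simp: A_def)
      have z: "p \<le> z - \<alpha> * x'" "z - \<alpha> * x' \<le> q" "0 \<le> x'"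
        using *(2) by (auto simp: parallelogram_def)
      have "0 \<le> \<alpha> * x'"
        using slope_pos z by simp
      then have "0 \<le> z"
        using z A by linarith
      then obtain k :: nat where k: "of_nat k \<le> z" "z < of_nat k + 1"
        using floor_natE by blast
      have "pt X s (x, y) = pt X ((upw X ^^ k) s0) (x', z - of_nat k)"
        using column_eq[OF k] *(3) by simp
      from pt_eq_interiorD[OF this xy] have eq: "(upw X ^^ k) s0 = s" "x' = x" "z = y + of_nat k"
        by auto
      define y0 where "y0 = y - \<alpha> * x + of_nat k"
      have "y0 \<noteq> p" "y0 \<noteq> q"
        using not_P[of k] A by (auto simp: y0_def)
      then have "p < y0" "y0 < q"
        using z eq by (auto simp: y0_def)
      then have "(s0, y0) \<in> orbit" "0 < y0" "y0 < 1"
        using A by auto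
      moreover have "y0 \<notin> special"
        using Q special_add_int[of "y - \<alpha> * x" "int k"] by (simp add: y0_def)
      ultimately have "(s0, y0) \<in> orbit \<inter> edge_points"
        using A by (simp add: edge_points_def)
      moreover have "y0 + \<alpha> * x = y + of_nat k"
        by (simp add: y0_def)
      ultimately show "pt X s (x, y) \<in> strip (orbit \<inter> edge_points)"
        unfolding strip_interior_iff[OF Int_lower2 xy] using eq by blast
    qed
  qed
  ultimately show ?thesis
    using equal_ae_trans[OF component_strip_orbit] by blast
qed

end

theorem theorem6:
  fixes X :: "'s barrier_system" and \<alpha> :: real and C G :: "'s pt set"
  assumes "\<alpha> > 0" and "\<alpha> \<notin> \<rat>"
    and "one_sided_barrier_system X"
    and "recurrent_component X \<alpha> C"
    and "openin (surface_topology X) G" and "G \<noteq> {}" and "G \<subseteq> C"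
  shows "(\<exists>T\<^sub>0\<ge>0. equal_ae X C (\<Union>t\<in>{0..T\<^sub>0}. advance X \<alpha> t G)) \<and>
         (\<exists>F. finite F \<and> (\<forall>Q\<in>F. surface_polygon X \<alpha> Q) \<and> equal_ae X C (\<Union>F))"
proof -
  interpret dissipative_flow X \<alpha>
    by unfold_locales (use assms in auto)
  obtain I t where "0 \<le> t" "open_sections I" "I \<subseteq> edges" "I \<noteq> {}"
    "\<forall>p\<in>I \<inter> edge_points. edge p \<in> advance X \<alpha> t G"
    by (rule open_set_reaches_edges[OF assms(5,6)])
  then interpret open_component X \<alpha> C G I t
    using assms by unfold_locales auto
  show ?thesis
    using component_finite_time orbit_polygons by blast
qed

end
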